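(* Let $N\ge 2$ be an integer, let $x_0<x_1<\dots<x_N$ be real numbers with $x_i-x_{i-1}=\frac{x_N-x_0}{N}$ for $1\le i\le N$, let $y_0,\dots,y_N\in\mathbb{R}$, and let $\alpha:[x_0,x_N]\to(0,1)$ be Lipschitz. Let $f:[x_0,x_N]\to\mathbb{R}$ be the associated generalized affine fractal interpolation function, i.e. the unique continuous function with $f(x_i)=y_i$ for $0\le i\le N$ and $$f(L_i(x))=\alpha(L_i(x))\,(f(x)-b(x))+h(L_i(x)),\qquad x\in[x_0,x_N],\ 1\le i\le N,$$ and let $\Gamma_G=\{(x,f(x)):x\in[x_0,x_N]\}\subset\mathbb{R}^2$ be its graph. Let $D^*$ be the upper box dimension of $\Gamma_G$. Then: (1) If $N\|\alpha\|_\infty\le 1$, then $\dim_A^\theta(\Gamma_G)=1$ for every $\theta\in(0,1)$. Consequently, $\dim_{qA}(\Gamma_G)=1$. (2) If $N\|\alpha\|_\infty>1$, then for every $\theta\in(0,1)$, $$\dim_A^\theta(\Gamma_G)\le\min\left\{2,\ D^*+\frac{\theta}{1-\theta}\left(1+\frac{\log\|\alpha\|_\infty}{\log N}\right)\right\}.$$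
   Context: Here $L_i:[x_0,x_N]\to[x_{i-1},x_i]$ is the affine map with $L_i(x_0)=x_{i-1}$, $L_i(x_N)=x_i$; $b$ is the affine function on $[x_0,x_N]$ with $b(x_0)=y_0$, $b(x_N)=y_N$; $h$ is the continuous piecewise affine function with $h(x_i)=y_i$ for $0\le i\le N$, affine on each $[x_{i-1},x_i]$. $\|\alpha\|_\infty=\max_{x\in[x_0,x_N]}|\alpha(x)|$. For a bounded set $E\subset\mathbb{R}^n$ and $r>0$, $N_r(E)$ is the minimum number of open balls of radius $r$ needed to cover $E$. The upper box dimension of a bounded $E\subset\mathbb{R}^2$ is $\limsup_{\varepsilon\to0^+}\frac{\log N_E(\varepsilon)}{\log(1/\varepsilon)}$, where $N_E(\varepsilon)$ is the number of squares $[m_1\varepsilon,(m_1+1)\varepsilon]\times[m_2\varepsilon,(m_2+1)\varepsilon]$, $m_1,m_2\in\mathbb{Z}$, meeting $E$. For $\theta\in(0,1)$ the Assouad spectrum of $F$ is $$\dim_A^\theta(F)=\inf\Big\{s:\ \exists C>0\ \forall\, 0<R<1\ \forall x\in F,\ N_{R^{1/\theta}}(B(x,R)\cap F)\le C\Big(\frac{R}{R^{1/\theta}}\Big)^{s}\Big\},$$ and the quasi-Assouad dimension is $\dim_{qA}(F)=\lim_{\theta\to1}\dim_A^\theta(F)$. *)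

theory Defs
  imports "HOL-Analysis.Analysis"
begin

text \<open>The plane is \<^typ>\<open>real \<times> real\<close>, whose library metric is the Euclidean one. Dimensions are
  extended reals, so that upper limits and infima are total; \<open>\<infinity>\<close> is the infimum of the empty set.\<close>

subsection \<open>Dimensions\<close>

definition covering_number :: "real \<Rightarrow> 'a::metric_space set \<Rightarrow> nat" where
  "covering_number r E =
     (LEAST k. \<exists>A. finite A \<and> card A = k \<and> E \<subseteq> (\<Union>c\<in>A. ball c r))"

definition mesh_square :: "real \<Rightarrow> int \<times> int \<Rightarrow> (real \<times> real) set" where
  "mesh_square \<epsilon> m =
     {of_int (fst m) * \<epsilon> .. (of_int (fst m) + 1) * \<epsilon>} \<times>
     {of_int (snd m) * \<epsilon> .. (of_int (snd m) + 1) * \<epsilon>}"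

definition mesh_count :: "(real \<times> real) set \<Rightarrow> real \<Rightarrow> nat" where
  "mesh_count E \<epsilon> = card {m. mesh_square \<epsilon> m \<inter> E \<noteq> {}}"

definition upper_box_dim :: "(real \<times> real) set \<Rightarrow> ereal" where
  "upper_box_dim E =
     Limsup (at_right 0) (\<lambda>\<epsilon>. ereal (ln (real (mesh_count E \<epsilon>)) / ln (1 / \<epsilon>)))"

definition assouad_spectrum :: "real \<Rightarrow> 'a::metric_space set \<Rightarrow> ereal" where
  "assouad_spectrum \<theta> F =
     Inf {ereal s | s. \<exists>C>0. \<forall>R. 0 < R \<and> R < 1 \<longrightarrow> (\<forall>p\<in>F.
       real (covering_number (R powr (1 / \<theta>)) (ball p R \<inter> F))
         \<le> C * (R / R powr (1 / \<theta>)) powr s)}"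

definition quasi_assouad_dim :: "'a::metric_space set \<Rightarrow> ereal" where
  "quasi_assouad_dim F = Lim (at_left 1) (\<lambda>\<theta>. assouad_spectrum \<theta> F)"

subsection \<open>Generalized affine fractal interpolation functions\<close>

definition affine_through :: "real \<Rightarrow> real \<Rightarrow> real \<Rightarrow> real \<Rightarrow> real \<Rightarrow> real" where
  "affine_through a c b d t = c + (t - a) * ((d - c) / (b - a))"

lemma affine_through_endpoints:
  "affine_through a c b d a = c" "a \<noteq> b \<Longrightarrow> affine_through a c b d b = d"
  by (simp_all add: affine_through_def)

definition fif_L :: "nat \<Rightarrow> (nat \<Rightarrow> real) \<Rightarrow> nat \<Rightarrow> real \<Rightarrow> real" where
  "fif_L N x i = affine_through (x 0) (x (i - 1)) (x N) (x i)"

definition fif_b :: "nat \<Rightarrow> (nat \<Rightarrow> real) \<Rightarrow> (nat \<Rightarrow> real) \<Rightarrow> real \<Rightarrow> real" where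
  "fif_b N x y = affine_through (x 0) (y 0) (x N) (y N)"

text \<open>The piecewise affine interpolant: on \<open>[x 0, x N]\<close> the least index \<open>i \<ge> 1\<close> with \<open>t \<le> x i\<close>
  selects a subinterval containing \<open>t\<close>; see \<open>fif_h_eq\<close> below.\<close>

definition fif_h :: "(nat \<Rightarrow> real) \<Rightarrow> (nat \<Rightarrow> real) \<Rightarrow> real \<Rightarrow> real" where
  "fif_h x y t =
     (let i = (LEAST i. 1 \<le> i \<and> t \<le> x i)
      in affine_through (x (i - 1)) (y (i - 1)) (x i) (y i) t)"

lemma fif_h_eq:
  fixes x y :: "nat \<Rightarrow> real"
  assumes x: "\<And>j. j < N \<Longrightarrow> x j < x (Suc j)" and i: "i \<in> {1..N}"
    and t: "t \<in> {x (i - 1)..x i}"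
  shows "fif_h x y t = affine_through (x (i - 1)) (y (i - 1)) (x i) (y i) t"
proof -
  have mono: "j < k \<Longrightarrow> k \<le> N \<Longrightarrow> x j < x k" for j k
  proof (induction k)
    case (Suc k)
    then show ?case using x[of k] by (cases "j = k") auto
  qed simp
  have iN: "i - 1 \<le> N" using i by (simp add: le_diff_conv)
  define l where "l = (LEAST i. 1 \<le> i \<and> t \<le> x i)"
  have l: "1 \<le> l \<and> t \<le> x l" unfolding l_def by (rule LeastI[of _ i]) (use i t in auto)
  have "l \<le> i" unfolding l_def by (rule Least_le) (use i t in auto)
  have h: "fif_h x y t = affine_through (x (l - 1)) (y (l - 1)) (x l) (y l) t"
    by (simp only: fif_h_def Let_def l_def)
  show ?thesis
  proof (cases "l = i")
    case True
    then show ?thesis by (simp add: h)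
  next
    case False
    then have "l \<le> i - 1" using \<open>l \<le> i\<close> by auto
    moreover have "\<not> l < i - 1" using mono[of l "i - 1", OF _ iN] l t by auto
    ultimately have li: "l = i - 1" by simp
    then have "t = x l" using l t by auto
    moreover have "x (l - 1) < x l" using mono[of "l - 1" l] l \<open>l \<le> i\<close> i by auto
    ultimately show ?thesis
      using li h by (simp add: affine_through_endpoints)
  qed
qed

definition is_generalized_affine_fif ::
  "nat \<Rightarrow> (nat \<Rightarrow> real) \<Rightarrow> (nat \<Rightarrow> real) \<Rightarrow> (real \<Rightarrow> real) \<Rightarrow> (real \<Rightarrow> real) \<Rightarrow> bool" where
  "is_generalized_affine_fif N x y \<alpha> f \<longleftrightarrow>
     continuous_on {x 0..x N} f \<and>
     (\<forall>i\<le>N. f (x i) = y i) \<and>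
     (\<forall>i\<in>{1..N}. \<forall>t\<in>{x 0..x N}.
        f (fif_L N x i t) =
          \<alpha> (fif_L N x i t) * (f t - fif_b N x y t) + fif_h x y (fif_L N x i t))"

definition graph_on :: "real set \<Rightarrow> (real \<Rightarrow> real) \<Rightarrow> (real \<times> real) set" where
  "graph_on S f = (\<lambda>t. (t, f t)) ` S"

text \<open>The norm is a maximum when \<open>\<alpha>\<close> is continuous on a compact \<open>S\<close>; \<^const>\<open>Max\<close> is meaningful
  only for finite sets.\<close>

definition sup_norm_on :: "real set \<Rightarrow> (real \<Rightarrow> real) \<Rightarrow> real" where
  "sup_norm_on S \<alpha> = (SUP t\<in>S. \<bar>\<alpha> t\<bar>)"

end

theory Submission
  imports Defs
begin

text \<open>
  Cut \<open>[x 0, x N]\<close> into the \<open>N^n\<close> cells of level \<open>n\<close>. The functional equation bounds the oscillation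
  of \<open>f\<close> on a cell of level \<open>n + 1\<close> by \<open>A\<close> times its oscillation on a cell of level \<open>n\<close>, up to an error
  \<open>O(N^-n)\<close>, since \<open>\<alpha>\<close>, \<open>b\<close> and the pieces of \<open>h\<close> are Lipschitz. Choose \<open>m\<close> and \<open>k\<close> with \<open>N^-m\<close> comparable to \<open>R\<close>
  and \<open>N^-(m+k)\<close> comparable to \<open>r = R^(1/\<theta>)\<close>. A ball of radius \<open>R\<close> meets the graph over boundedly many cells of
  level \<open>m\<close>, and over a subcell of level \<open>m + k\<close> the number of \<open>r\<close>-balls needed is of the order of one plus
  the oscillation times \<open>N^(m+k)\<close>.

  If \<open>N A \<le> 1\<close>, that number is \<open>O(m + k)\<close>, a logarithm of \<open>R / r\<close>, so the exponent is at most 1; it is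
  at least 1 because the graph is connected. If \<open>N A > 1\<close>, iterating the oscillation bound \<open>m\<close> times
  compares the sum over the subcells of one cell of level \<open>m\<close> with \<open>(N A)^m\<close> times the sum over all cells
  of level \<open>k\<close>. The latter is at most a constant times the mesh count of the graph at scale \<open>N^-k\<close>, hence
  \<open>O((R / r)^s)\<close> for every \<open>s > D\<^sup>*\<close>, while \<open>(N A)^m\<close> is at most \<open>R\<close> to the power \<open>- (1 + ln A / ln N)\<close>, which is the power
  \<open>\<theta> / (1 - \<theta>) (1 + ln A / ln N)\<close> of \<open>R / r\<close>.
\<close>

subsection \<open>Covering numbers and the Assouad spectrum\<close>

text \<open>The \<open>LEAST\<close> in \<open>covering_number\<close> says something only once a
  finite cover exists. This predicate carries existence and a real bound together, so that covers
  can be united and enlarged before passing to the least number.\<close>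

definition coverable :: "real \<Rightarrow> 'a::metric_space set \<Rightarrow> real \<Rightarrow> bool" where
  "coverable r E c \<longleftrightarrow> (\<exists>A. finite A \<and> real (card A) \<le> c \<and> E \<subseteq> (\<Union>a\<in>A. ball a r))"

lemma covering_number_le:
  assumes "coverable r E c"
  shows "real (covering_number r E) \<le> c"
proof -
  obtain A where A: "finite A" "real (card A) \<le> c" "E \<subseteq> (\<Union>a\<in>A. ball a r)"
    using assms unfolding coverable_def by blast
  have "covering_number r E \<le> card A"
    unfolding covering_number_def by (rule Least_le) (use A in blast)
  then show ?thesis using A(2) by linarith
qed

lemma covering_number_attained:
  assumes "coverable r E c"
  obtains A where "finite A" "card A = covering_number r E" "E \<subseteq> (\<Union>a\<in>A. ball a r)"
proof -
  have "\<exists>k A. finite A \<and> card A = k \<and> E \<subseteq> (\<Union>a\<in>A. ball a r)"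
    using assms unfolding coverable_def by blast
  from LeastI_ex[OF this] show ?thesis
    using that unfolding covering_number_def by blast
qed

lemma coverable_mono:
  assumes "coverable r E c" "E' \<subseteq> E" "c \<le> c'"
  shows "coverable r E' c'"
proof -
  obtain A where "finite A" "real (card A) \<le> c" "E \<subseteq> (\<Union>a\<in>A. ball a r)"
    using assms(1) unfolding coverable_def by blast
  then show ?thesis
    unfolding coverable_def using assms(2,3) by (intro exI[of _ A]) auto
qed

lemma coverable_UN:
  assumes "finite I" and "\<And>i. i \<in> I \<Longrightarrow> coverable r (E i) (c i)"
  shows "coverable r (\<Union>i\<in>I. E i) (\<Sum>i\<in>I. c i)"
proof -
  have "\<forall>i\<in>I. \<exists>A. finite A \<and> real (card A) \<le> c i \<and> E i \<subseteq> (\<Union>a\<in>A. ball a r)"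
    using assms(2) unfolding coverable_def by blast
  then obtain A where A: "\<forall>i\<in>I. finite (A i) \<and> real (card (A i)) \<le> c i \<and> E i \<subseteq> (\<Union>a\<in>A i. ball a r)"
    by metis
  have "real (card (\<Union>i\<in>I. A i)) \<le> real (\<Sum>i\<in>I. card (A i))"
    by (simp only: of_nat_le_iff card_UN_le[OF assms(1)])
  also have "\<dots> \<le> (\<Sum>i\<in>I. c i)"
    using A by (auto intro!: sum_mono)
  finally have "real (card (\<Union>i\<in>I. A i)) \<le> (\<Sum>i\<in>I. c i)" .
  moreover have "(\<Union>i\<in>I. E i) \<subseteq> (\<Union>a\<in>(\<Union>i\<in>I. A i). ball a r)"
  proof (rule UN_least)
    fix i assume i: "i \<in> I"
    then have "E i \<subseteq> (\<Union>a\<in>A i. ball a r)" using A by blast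
    also have "\<dots> \<subseteq> (\<Union>a\<in>(\<Union>i\<in>I. A i). ball a r)"
      using i by (intro UN_mono) auto
    finally show "E i \<subseteq> (\<Union>a\<in>(\<Union>i\<in>I. A i). ball a r)" .
  qed
  moreover have "finite (\<Union>i\<in>I. A i)"
    using A assms(1) by simp
  ultimately show ?thesis
    unfolding coverable_def by blast
qed

text \<open>Balls are centred on a grid of spacing \<open>r / 2\<close>: rounding both coordinates
  down leaves errors below \<open>r / 2\<close>, and the Euclidean distance is at most their
  sum.\<close>

lemma coverable_box:
  fixes a b w h r :: real
  assumes "0 < r" "0 \<le> w" "0 \<le> h"
  shows "coverable r ({a..a + w} \<times> {b..b + h}) ((2 * w / r + 1) * (2 * h / r + 1))"
proof -
  define I where "I z = {0..\<lfloor>2 * z / r\<rfloor>}" for z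
  have card: "real (card (I z)) \<le> 2 * z / r + 1" if "0 \<le> z" for z
  proof -
    have "0 \<le> 2 * z / r" using that assms by simp
    then show ?thesis unfolding I_def by simp
  qed
  define c where "c = (\<lambda>(i, j). (a + of_int i * (r / 2), b + of_int j * (r / 2)))"
  have near: "\<exists>i\<in>I z. \<bar>u - of_int i * (r / 2)\<bar> < r / 2" if "0 \<le> u" "u \<le> z" for u z
  proof (rule bexI[of _ "\<lfloor>2 * u / r\<rfloor>"])
    show "\<lfloor>2 * u / r\<rfloor> \<in> I z"
      unfolding I_def using that assms by (auto intro!: floor_mono divide_right_mono)
    define k :: real where "k = of_int \<lfloor>2 * u / r\<rfloor>"
    have "k \<le> 2 * u / r" "2 * u / r < k + 1"
      unfolding k_def by linarith+
    then have "k * r \<le> 2 * u" "2 * u < k * r + r"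
      using assms(1) by (simp_all add: field_simps)
    then show "\<bar>u - of_int \<lfloor>2 * u / r\<rfloor> * (r / 2)\<bar> < r / 2"
      unfolding k_def[symmetric] using assms(1) by (simp add: abs_if)
  qed
  have "{a..a + w} \<times> {b..b + h} \<subseteq> (\<Union>q\<in>c ` (I w \<times> I h). ball q r)"
  proof clarify
    fix u v assume uv: "u \<in> {a..a + w}" "v \<in> {b..b + h}"
    obtain i where i: "i \<in> I w" "\<bar>(u - a) - of_int i * (r / 2)\<bar> < r / 2"
      using near[of "u - a" w] uv by auto
    obtain j where j: "j \<in> I h" "\<bar>(v - b) - of_int j * (r / 2)\<bar> < r / 2"
      using near[of "v - b" h] uv by auto
    have "dist (c (i, j)) (u, v) \<le> \<bar>(u - a) - of_int i * (r / 2)\<bar> + \<bar>(v - b) - of_int j * (r / 2)\<bar>"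
    proof -
      have "dist (c (i, j)) (u, v)
          \<le> dist (a + of_int i * (r / 2)) u + dist (b + of_int j * (r / 2)) v"
        unfolding c_def by (simp add: dist_Pair_Pair sqrt_sum_squares_le_sum)
      then show ?thesis by (simp add: dist_real_def abs_minus_commute algebra_simps)
    qed
    then have "(u, v) \<in> ball (c (i, j)) r" using i(2) j(2) by simp
    then show "(u, v) \<in> (\<Union>q\<in>c ` (I w \<times> I h). ball q r)" using i(1) j(1) by blast
  qed
  moreover have "real (card (c ` (I w \<times> I h))) \<le> (2 * w / r + 1) * (2 * h / r + 1)"
  proof -
    have "card (c ` (I w \<times> I h)) \<le> card (I w) * card (I h)"
      using card_image_le[of "I w \<times> I h" c] by (simp add: I_def)
    then have "real (card (c ` (I w \<times> I h))) \<le> real (card (I w)) * real (card (I h))"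
      by (metis of_nat_le_iff of_nat_mult)
    also have "\<dots> \<le> (2 * w / r + 1) * (2 * h / r + 1)"
      using card assms by (intro mult_mono) auto
    finally show ?thesis .
  qed
  moreover have "finite (c ` (I w \<times> I h))" by (simp add: I_def)
  ultimately show ?thesis unfolding coverable_def by blast
qed

lemma ball_Pair_subset_box:
  fixes p :: "real \<times> real"
  shows "ball p R \<subseteq> {fst p - R..fst p - R + 2 * R} \<times> {snd p - R..snd p - R + 2 * R}"
proof
  fix q assume "q \<in> ball p R"
  then have "dist (fst p) (fst q) < R" "dist (snd p) (snd q) < R"
    using dist_fst_le[of p q] dist_snd_le[of p q] by auto
  then show "q \<in> {fst p - R..fst p - R + 2 * R} \<times> {snd p - R..snd p - R + 2 * R}"
    by (cases q) (auto simp: dist_real_def)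
qed

text \<open>The ball lies in a square of side \<open>2 * R\<close>, and \<open>1 \<le> R / r\<close>
  absorbs the additive 1 into \<open>5 * (R / r)\<close>. This yields the trivial exponent 2 and the
  finite covers that \<open>covering_number_ge\<close> asks for.\<close>

lemma coverable_ball_Pair:
  fixes p :: "real \<times> real"
  assumes "0 < r" "r \<le> R"
  shows "coverable r (ball p R) (25 * (R / r)\<^sup>2)"
proof -
  have "coverable r (ball p R) ((2 * (2 * R) / r + 1) * (2 * (2 * R) / r + 1))"
    using assms by (intro coverable_mono[OF coverable_box ball_Pair_subset_box]) auto
  moreover have "(2 * (2 * R) / r + 1) * (2 * (2 * R) / r + 1) \<le> (5 * (R / r)) * (5 * (R / r))"
  proof (rule mult_mono)
    have "1 \<le> R / r" using assms by simp
    then show "2 * (2 * R) / r + 1 \<le> 5 * (R / r)" by simp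
    then show "2 * (2 * R) / r + 1 \<le> 5 * (R / r)" .
  qed (use assms in auto)
  moreover have "(5 * (R / r)) * (5 * (R / r)) = 25 * (R / r)\<^sup>2"
    by (simp add: power2_eq_square)
  ultimately show ?thesis
    using coverable_mono by (metis order_refl)
qed

text \<open>The distance to \<open>p\<close> is 1-Lipschitz, so it maps a cover of \<open>E\<close> to a cover of \<open>[0, R)\<close> by intervals
  of length \<open>2 r\<close>.\<close>

lemma covering_number_ge:
  assumes "coverable r E c" "0 < r" "{0..<R} \<subseteq> dist p ` E" "0 \<le> R"
  shows "R / (2 * r) \<le> real (covering_number r E)"
proof -
  obtain A where A: "finite A" "card A = covering_number r E" "E \<subseteq> (\<Union>a\<in>A. ball a r)"
    using covering_number_attained[OF assms(1)] .
  have sub: "{0..<R} \<subseteq> (\<Union>a\<in>A. ball (dist p a) r)"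
  proof
    fix u assume "u \<in> {0..<R}"
    then obtain q where q: "q \<in> E" "u = dist p q" using assms(3) by blast
    then obtain a where a: "a \<in> A" "dist a q < r" using A(3) by auto
    have "\<bar>dist p a - dist p q\<bar> \<le> dist a q"
      by (metis abs_dist_diff_le dist_commute)
    then have "u \<in> ball (dist p a) r" using a q by (simp add: dist_real_def)
    then show "u \<in> (\<Union>a\<in>A. ball (dist p a) r)" using a by blast
  qed
  have "R = measure lborel {0..<R}" using assms(4) by simp
  also have "\<dots> \<le> measure lborel (\<Union>a\<in>A. ball (dist p a) r)"
    using A(1) by (intro measure_mono_fmeasurable[OF sub] fmeasurable.finite_UN fmeasurableI
        emeasure_bounded_finite) auto
  also have "\<dots> \<le> (\<Sum>a\<in>A. measure lborel (ball (dist p a) r))"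
    using A(1) by (intro measure_UNION_le) auto
  also have "\<dots> = real (card A) * (2 * r)"
    using assms(2) by (simp add: ball_eq_greaterThanLessThan)
  finally show ?thesis using A(2) assms(2) by (simp add: field_simps)
qed

lemma powr_inverse_le:
  fixes R \<theta> :: real
  assumes "0 < R" "R < 1" "\<theta> \<in> {0<..<1}"
  shows "0 < R powr (1 / \<theta>)" "R powr (1 / \<theta>) < R"
proof -
  have "1 < 1 / \<theta>" using assms by simp
  then have "R powr (1 / \<theta>) < R powr 1" using assms by (intro powr_less_mono') auto
  then show "R powr (1 / \<theta>) < R" "0 < R powr (1 / \<theta>)" using assms by auto
qed

lemma assouad_spectrum_leI:
  assumes "0 < C" and "\<And>R p. 0 < R \<Longrightarrow> R < 1 \<Longrightarrow> p \<in> F \<Longrightarrow>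
    coverable (R powr (1 / \<theta>)) (ball p R \<inter> F) (C * (R / R powr (1 / \<theta>)) powr s)"
  shows "assouad_spectrum \<theta> F \<le> ereal s"
  unfolding assouad_spectrum_def
  by (rule Inf_lower) (use assms covering_number_le in blast)

lemma assouad_spectrum_le_2:
  fixes F :: "(real \<times> real) set"
  assumes "\<theta> \<in> {0<..<1}"
  shows "assouad_spectrum \<theta> F \<le> 2"
proof -
  have "assouad_spectrum \<theta> F \<le> ereal 2"
  proof (rule assouad_spectrum_leI[of 25])
    fix R :: real and p :: "real \<times> real" assume R: "0 < R" "R < 1"
    define r where "r = R powr (1 / \<theta>)"
    have r: "0 < r" "r < R" using powr_inverse_le[OF R assms] by (auto simp: r_def)
    have "coverable r (ball p R) (25 * (R / r)\<^sup>2)"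
      using r by (intro coverable_ball_Pair) auto
    moreover have "(R / r)\<^sup>2 = (R / r) powr 2"
      using r R by simp
    ultimately show "coverable (R powr (1 / \<theta>)) (ball p R \<inter> F) (25 * (R / R powr (1 / \<theta>)) powr 2)"
      using coverable_mono[OF _ Int_lower1 order_refl] by (simp only: r_def)
  qed auto
  then show ?thesis by (simp only: numeral_eq_ereal)
qed

text \<open>Connectedness makes the distance to \<open>p\<close> take every value up to
  \<open>dist p q\<close> on \<open>F\<close>, so at least \<open>R / (2 * r)\<close> balls are
  needed near \<open>p\<close>. An exponent \<open>s < 1\<close> would keep
  \<open>(R / r) powr (1 - s)\<close> bounded as \<open>R\<close> tends to 0, although
  \<open>R / r\<close> tends to infinity.\<close>

lemma assouad_spectrum_connected_ge_1:
  fixes F :: "(real \<times> real) set"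
  assumes \<theta>: "\<theta> \<in> {0<..<1}" and "connected F" "p \<in> F" "q \<in> F" "p \<noteq> q"
  shows "1 \<le> assouad_spectrum \<theta> F"
proof -
  have "1 \<le> s" if "0 < C" and s: "\<And>R p. 0 < R \<Longrightarrow> R < 1 \<Longrightarrow> p \<in> F \<Longrightarrow>
      real (covering_number (R powr (1 / \<theta>)) (ball p R \<inter> F)) \<le> C * (R / R powr (1 / \<theta>)) powr s"
    for s C
  proof (rule ccontr)
    assume "\<not> 1 \<le> s"
    have conn: "connected (dist p ` F)"
      by (intro connected_continuous_image continuous_intros assms)
    have sub: "{0..<R} \<subseteq> dist p ` (ball p R \<inter> F)" if "R \<le> dist p q" for R
    proof
      fix u assume u: "u \<in> {0..<R}"
      have "{dist p p..dist p q} \<subseteq> dist p ` F"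
        using conn assms by (intro connected_contains_Icc) auto
      then have "u \<in> dist p ` F" using u that by auto
      then show "u \<in> dist p ` (ball p R \<inter> F)" using u by auto
    qed
    have key: "(R powr (1 - 1 / \<theta>)) powr (1 - s) \<le> 2 * C"
      if R: "0 < R" "R < 1" "R \<le> dist p q" for R
    proof -
      define r where "r = R powr (1 / \<theta>)"
      have r: "0 < r" "r < R" using powr_inverse_le[OF R(1,2) \<theta>] by (auto simp: r_def)
      have "R / (2 * r) \<le> real (covering_number r (ball p R \<inter> F))"
        using sub[OF R(3)] r R
        by (intro covering_number_ge[OF coverable_mono[OF coverable_ball_Pair[of r R p]]]) auto
      also have "\<dots> \<le> C * (R / r) powr s" using s[OF R(1,2) assms(3)] by (simp add: r_def)
      finally have "R / (2 * r) \<le> C * (R / r) powr s" .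
      moreover have "R / r = 2 * (R / (2 * r))" by simp
      ultimately have "R / r \<le> (2 * C) * (R / r) powr s" by linarith
      then have "(R / r) powr (1 - s) \<le> 2 * C"
        using r R by (simp only: powr_diff divide_le_eq) (simp add: divide_simps)
      moreover have "R / r = R powr (1 - 1 / \<theta>)" using R by (simp add: r_def powr_diff)
      ultimately show ?thesis by simp
    qed
    \<comment> \<open>With this \<open>c\<close> the left side of \<open>key\<close> is
      \<open>R powr - c\<close>; \<open>R\<close> is then taken so small that this is at least
      \<open>2 * C + 1\<close>, against \<open>key\<close>.\<close>
    define c where "c = (1 / \<theta> - 1) * (1 - s)"
    have "0 < c"
      using \<open>\<not> 1 \<le> s\<close> \<theta> unfolding c_def by (intro mult_pos_pos) auto
    define R where "R = min (min (1 / 2) (dist p q)) ((2 * C + 1) powr (- 1 / c))"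
    have R: "0 < R" "R < 1" "R \<le> dist p q" "R \<le> (2 * C + 1) powr (- 1 / c)"
      using assms(5) \<open>0 < C\<close> by (auto simp: R_def)
    have "2 * C + 1 = ((2 * C + 1) powr (- 1 / c)) powr - c"
      using \<open>0 < c\<close> \<open>0 < C\<close> by (simp add: powr_powr)
    also have "\<dots> \<le> R powr - c"
      using R \<open>0 < c\<close> by (intro powr_mono2') auto
    also have "\<dots> = (R powr (1 - 1 / \<theta>)) powr (1 - s)"
      by (simp add: powr_powr c_def algebra_simps)
    also have "\<dots> \<le> 2 * C" by (rule key[OF R(1-3)])
    finally show False by simp
  qed
  then show ?thesis
    unfolding assouad_spectrum_def by (intro Inf_greatest) (auto simp: one_ereal_def)
qed

subsection \<open>Powers and mesh squares\<close>

lemma card_nat_interval_le: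
  fixes a b :: real
  assumes "\<And>j. j \<in> S \<Longrightarrow> a \<le> real j \<and> real j \<le> b" "a \<le> b"
  shows "real (card S) \<le> b - a + 1"
proof -
  have "int ` S \<subseteq> {\<lceil>a\<rceil>..\<lfloor>b\<rfloor>}"
    using assms(1) by (auto simp: ceiling_le_iff le_floor_iff)
  then have "card (int ` S) \<le> card {\<lceil>a\<rceil>..\<lfloor>b\<rfloor>}" by (intro card_mono) auto
  then have "card S \<le> nat (\<lfloor>b\<rfloor> - \<lceil>a\<rceil> + 1)" by (simp add: card_image)
  then show ?thesis using assms(2) by linarith
qed

lemma ex_power_between:
  fixes b z :: real
  assumes "1 < b" "1 \<le> z"
  obtains m where "b ^ m \<le> z" "z < b ^ Suc m"
proof -
  obtain n where n: "z < b ^ n" using real_arch_pow[OF assms(1)] by blast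
  define l where "l = (LEAST n. z < b ^ n)"
  have l: "z < b ^ l" unfolding l_def by (rule LeastI[of "\<lambda>n. z < b ^ n", OF n])
  then obtain m where m: "l = Suc m" using assms(2) by (cases l) auto
  then have "\<not> z < b ^ m" using not_less_Least[of m "\<lambda>n. z < b ^ n"] l_def by simp
  then show ?thesis using that[of m] l m by simp
qed

text \<open>\<open>mesh_count\<close> is a \<open>card\<close>, which is 0 for infinite sets, so it
  can serve as an upper bound only after finiteness is known.\<close>

lemma finite_mesh_squares:
  assumes "bounded E" "0 < \<epsilon>"
  shows "finite {m. mesh_square \<epsilon> m \<inter> E \<noteq> {}}"
proof -
  obtain B where B: "\<And>q. q \<in> E \<Longrightarrow> norm q \<le> B" using assms(1) unfolding bounded_iff by blast
  \<comment> \<open>The \<open>- 1\<close> at the lower end is there because the constraint from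
    below concerns the far edge \<open>of_int k + 1\<close> of the square.\<close>
  define M where "M = {\<lfloor>- B / \<epsilon>\<rfloor> - 1..\<lceil>B / \<epsilon>\<rceil>}"
  have range: "k \<in> M" if "\<bar>u\<bar> \<le> B" "of_int k * \<epsilon> \<le> u" "u \<le> (of_int k + 1) * \<epsilon>" for k u
  proof -
    have "of_int k * \<epsilon> \<le> B" "- B \<le> (of_int k + 1) * \<epsilon>" using that by linarith+
    then have "of_int k \<le> B / \<epsilon>" "- B / \<epsilon> \<le> of_int k + 1"
      using assms(2) by (simp_all only: pos_le_divide_eq pos_divide_le_eq)
    then show ?thesis unfolding M_def by simp linarith
  qed
  have "{m. mesh_square \<epsilon> m \<inter> E \<noteq> {}} \<subseteq> M \<times> M"
  proof
    fix m assume "m \<in> {m. mesh_square \<epsilon> m \<inter> E \<noteq> {}}"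
    then obtain u v where "(u, v) \<in> mesh_square \<epsilon> m" "(u, v) \<in> E" by auto
    moreover obtain i j where m: "m = (i, j)" by (cases m)
    ultimately have uv: "(u, v) \<in> mesh_square \<epsilon> (i, j)" "(u, v) \<in> E" by auto
    have "\<bar>u\<bar> \<le> B" "\<bar>v\<bar> \<le> B"
      using B[OF uv(2)] norm_fst_le[of u v] norm_snd_le[of v u] by simp_all
    then show "m \<in> M \<times> M" using uv(1) range unfolding m mesh_square_def by auto
  qed
  then show ?thesis by (rule finite_subset) (simp add: M_def)
qed

text \<open>The image is an interval, so each horizontal strip of the mesh indexed between the
  floors of \<open>a / \<delta>\<close> and \<open>b / \<delta>\<close> contains a square meeting
  the graph. The number of these strips is at least 1 and at least
  \<open>(b - a) / \<delta>\<close>; adding both bounds gives the factor 2.\<close>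

lemma mesh_column_count:
  fixes a b \<delta> :: real
  assumes "0 < \<delta>" "f ` S = {a..b}" "a \<le> b"
    and fin: "finite {m. mesh_square \<delta> m \<inter> graph_on S f \<noteq> {}}"
  shows "1 + (b - a) / \<delta> \<le> 2 * real (card {m. mesh_square \<delta> m \<inter> graph_on S f \<noteq> {}})"
    (is "_ \<le> 2 * real (card ?Q)")
proof -
  have sub: "{\<lfloor>a / \<delta>\<rfloor>..\<lfloor>b / \<delta>\<rfloor>} \<subseteq> snd ` ?Q"
  proof
    fix k assume k: "k \<in> {\<lfloor>a / \<delta>\<rfloor>..\<lfloor>b / \<delta>\<rfloor>}"
    have "of_int k \<le> b / \<delta>" "a / \<delta> < of_int k + 1"
      using k by (auto simp: le_floor_iff) linarith
    then have *: "of_int k * \<delta> \<le> b" "a < (of_int k + 1) * \<delta>"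
      using assms(1) by (simp_all only: pos_le_divide_eq pos_divide_less_eq)
    have "of_int k * \<delta> \<le> (of_int k + 1) * \<delta>" using assms(1) by simp
    define v where "v = max a (of_int k * \<delta>)"
    have v: "v \<in> {a..b}" "of_int k * \<delta> \<le> v" "v \<le> (of_int k + 1) * \<delta>"
      using * assms(1,3) by (auto simp: v_def algebra_simps)
    then obtain t where t: "t \<in> S" "f t = v" using assms(2) by (metis imageE)
    define i where "i = \<lfloor>t / \<delta>\<rfloor>"
    have "of_int i \<le> t / \<delta>" "t / \<delta> \<le> of_int i + 1" unfolding i_def by linarith+
    then have "of_int i * \<delta> \<le> t" "t \<le> (of_int i + 1) * \<delta>"
      using assms(1) by (simp_all only: pos_le_divide_eq pos_divide_le_eq)
    then have "(t, v) \<in> mesh_square \<delta> (i, k) \<inter> graph_on S f"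
      using v t by (auto simp: mesh_square_def graph_on_def)
    then have "(i, k) \<in> ?Q" by blast
    then show "k \<in> snd ` ?Q" by force
  qed
  have "card {\<lfloor>a / \<delta>\<rfloor>..\<lfloor>b / \<delta>\<rfloor>} \<le> card ?Q"
    using card_mono[OF _ sub] card_image_le[OF fin, of snd] fin by fastforce
  moreover have "\<lfloor>a / \<delta>\<rfloor> \<le> \<lfloor>b / \<delta>\<rfloor>"
    using assms by (intro floor_mono divide_right_mono) auto
  moreover have "(b - a) / \<delta> = b / \<delta> - a / \<delta>" by (rule diff_divide_distrib)
  ultimately show ?thesis by simp linarith
qed

lemma affine_through_diff:
  "affine_through a c b d s - affine_through a c b d t = (s - t) * ((d - c) / (b - a))"
proof -
  define g where "g = (d - c) / (b - a)"
  have "(s - a) * g - (t - a) * g = (s - t) * g" by (simp add: algebra_simps)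
  then show ?thesis by (simp only: affine_through_def g_def add_diff_cancel_left)
qed

subsection \<open>Oscillation on cells\<close>

locale affine_fif =
  fixes N :: nat and x y :: "nat \<Rightarrow> real" and \<alpha> f :: "real \<Rightarrow> real"
  assumes N_ge_2: "N \<ge> 2"
    and x_less: "\<And>i. i < N \<Longrightarrow> x i < x (Suc i)"
    and x_step: "\<And>i. i \<in> {1..N} \<Longrightarrow> x i - x (i - 1) = (x N - x 0) / real N"
    and \<alpha>_range: "\<And>t. t \<in> {x 0..x N} \<Longrightarrow> \<alpha> t \<in> {0<..<1}"
    and \<alpha>_lipschitz: "\<exists>K. K-lipschitz_on {x 0..x N} \<alpha>"
    and fif: "is_generalized_affine_fif N x y \<alpha> f"
begin

definition len :: real where "len = x N - x 0"

text \<open>For \<open>j < N ^ n\<close>, read \<open>j\<close> as \<open>n\<close> digits in base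
  \<open>N\<close>. Dropping trailing digits gives a larger cell containing this one; dropping
  leading digits gives a larger cell that the maps \<open>fif_L\<close> carry onto it.\<close>

definition cell :: "nat \<Rightarrow> nat \<Rightarrow> real set" where
  "cell n j = {x 0 + real j * len / real N ^ n .. x 0 + (real j + 1) * len / real N ^ n}"

definition osc :: "nat \<Rightarrow> nat \<Rightarrow> real" where
  "osc n j = diameter (f ` cell n j)"

abbreviation "\<Gamma> \<equiv> graph_on {x 0..x N} f"

abbreviation "A \<equiv> sup_norm_on {x 0..x N} \<alpha>"

lemma N_pos: "0 < real N" and N_gt_1: "1 < real N"
  using N_ge_2 by auto

lemma x_eq: "i \<le> N \<Longrightarrow> x i = x 0 + real i * len / real N"
proof (induction i)
  case (Suc i)
  then show ?case
    using x_step[of "Suc i"] by (simp add: len_def distrib_right add_divide_distrib)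
qed simp

lemma len_pos: "0 < len"
proof -
  have "0 < x 1 - x 0" using x_less[of 0] N_ge_2 by simp
  also have "\<dots> = len / real N" using x_step[of 1] N_ge_2 by (simp add: len_def)
  finally show ?thesis using N_pos by (simp add: zero_less_divide_iff)
qed

lemma xN_eq: "x N = x 0 + len"
  by (simp add: len_def)

lemma bdd_above_\<alpha>: "bdd_above ((\<lambda>t. \<bar>\<alpha> t\<bar>) ` {x 0..x N})"
  by (rule bdd_aboveI2[of _ _ 1]) (use \<alpha>_range in force)

lemma \<alpha>_le_A: "t \<in> {x 0..x N} \<Longrightarrow> \<alpha> t \<le> A"
  unfolding sup_norm_on_def
  using cSUP_upper[OF _ bdd_above_\<alpha>, of t] by linarith

lemma A_pos: "0 < A"
proof -
  have "x 0 \<in> {x 0..x N}" using len_pos by (simp add: len_def)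
  then show ?thesis using \<alpha>_range[of "x 0"] \<alpha>_le_A[of "x 0"] by fastforce
qed

lemma continuous_f: "continuous_on {x 0..x N} f"
  using fif by (simp add: is_generalized_affine_fif_def)

lemma f_fif_L: "i \<in> {1..N} \<Longrightarrow> t \<in> {x 0..x N} \<Longrightarrow> f (fif_L N x i t) =
    \<alpha> (fif_L N x i t) * (f t - fif_b N x y t) + fif_h x y (fif_L N x i t)"
  using fif by (simp add: is_generalized_affine_fif_def)

lemma cell_subset:
  assumes "j < N ^ n"
  shows "cell n j \<subseteq> {x 0..x N}"
proof -
  have "real (Suc j) \<le> real (N ^ n)" using assms by (simp only: of_nat_le_iff Suc_le_eq)
  then have "real j + 1 \<le> real N ^ n" by simp
  then have "(real j + 1) * len \<le> real N ^ n * len"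
    using len_pos by (intro mult_right_mono) auto
  then have "(real j + 1) * len / real N ^ n \<le> len"
    using N_pos by (simp add: divide_le_eq mult.commute)
  moreover have "0 \<le> real j * len / real N ^ n" using len_pos by simp
  ultimately show ?thesis unfolding cell_def xN_eq by auto
qed

lemma cell_0: "cell 0 0 = {x 0..x N}"
  by (simp add: cell_def xN_eq)

text \<open>Continuity makes the image of a compact interval a closed interval, so the diameter
  \<open>osc n j\<close> is its length and both extremes are attained.\<close>

lemma f_image_cell:
  assumes "j < N ^ n"
  obtains a where "f ` cell n j = {a..a + osc n j}" "0 \<le> osc n j"
proof -
  have "continuous_on (cell n j) f"
    using continuous_on_subset[OF continuous_f cell_subset[OF assms]] .
  moreover have "x 0 + real j * len / real N ^ n \<le> x 0 + (real j + 1) * len / real N ^ n"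
    using len_pos by (intro add_left_mono divide_right_mono mult_right_mono) auto
  ultimately obtain a b where ab: "f ` cell n j = {a..b}" "a \<le> b"
    unfolding cell_def using continuous_image_closed_interval by metis
  then have "osc n j = b - a" by (simp add: osc_def)
  then show ?thesis using ab that[of a] by simp
qed

lemma osc_nonneg: "j < N ^ n \<Longrightarrow> 0 \<le> osc n j"
  using f_image_cell by blast

lemma abs_diff_le_osc:
  assumes "j < N ^ n" "s \<in> cell n j" "t \<in> cell n j"
  shows "\<bar>f s - f t\<bar> \<le> osc n j"
proof -
  obtain a where "f ` cell n j = {a..a + osc n j}" using f_image_cell[OF assms(1)] .
  then have "f s \<in> {a..a + osc n j}" "f t \<in> {a..a + osc n j}" using assms by blast+
  then show ?thesis by auto
qed

lemma osc_leI:
  assumes "j < N ^ n" "\<And>s t. s \<in> cell n j \<Longrightarrow> t \<in> cell n j \<Longrightarrow> f s - f t \<le> c"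
  shows "osc n j \<le> c"
proof -
  obtain a where a: "f ` cell n j = {a..a + osc n j}" "0 \<le> osc n j"
    using f_image_cell[OF assms(1)] .
  then have "a \<in> f ` cell n j" "a + osc n j \<in> f ` cell n j" by auto
  then obtain s t where "t \<in> cell n j" "a = f t" "s \<in> cell n j" "a + osc n j = f s" by blast
  then show ?thesis using assms(2)[of s t] by linarith
qed

lemma cell_dist: "s \<in> cell n j \<Longrightarrow> t \<in> cell n j \<Longrightarrow> \<bar>s - t\<bar> \<le> len / real N ^ n"
  unfolding cell_def by (auto simp: abs_le_iff algebra_simps add_divide_distrib)

section \<open>Self-affinity: the maps \<open>fif_L\<close> on cells and the recursion for
  \<open>osc\<close>\<close>

lemma fif_L_eq: "i \<in> {1..N} \<Longrightarrow> fif_L N x i t = x (i - 1) + (t - x 0) / real N"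
  using x_step[of i] len_pos by (simp add: fif_L_def affine_through_def len_def)

text \<open>\<open>q div N ^ n\<close> is the leading digit of \<open>q\<close>; undoing the
  corresponding map, a dilation by \<open>N\<close>, removes it. Digits start at 0 and the maps at
  index 1, hence the \<open>Suc\<close>.\<close>

lemma fif_L_cell:
  assumes q: "q < N ^ Suc n" and t: "t \<in> cell (Suc n) q"
  obtains s where "s \<in> cell n (q mod N ^ n)" "fif_L N x (Suc (q div N ^ n)) s = t"
proof -
  define i where "i = q div N ^ n"
  have "i < N" using q unfolding i_def by (simp add: less_mult_imp_div_less)
  define s where "s = x 0 + real N * (t - x i)"
  have xi: "x i = x 0 + real i * len / real N" using x_eq[of i] \<open>i < N\<close> by linarith
  have "q = i * N ^ n + q mod N ^ n" by (simp only: i_def div_mult_mod_eq)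
  then have "real q = real (i * N ^ n + q mod N ^ n)" by (rule arg_cong)
  then have rq: "real q = real i * real N ^ n + real (q mod N ^ n)" by simp
  have pw: "real N ^ n \<noteq> 0" using N_pos by simp
  have e: "real N * ((c + real i * real N ^ n) * len / real N ^ Suc n - real i * len / real N)
      = c * len / real N ^ n" for c
    using N_pos pw by (simp add: field_simps)
  have "x 0 + real q * len / real N ^ Suc n \<le> t" "t \<le> x 0 + (real q + 1) * len / real N ^ Suc n"
    using t by (simp_all add: cell_def)
  then have "real N * (real q * len / real N ^ Suc n - real i * len / real N) \<le> real N * (t - x i)"
    "real N * (t - x i) \<le> real N * ((real q + 1) * len / real N ^ Suc n - real i * len / real N)"
    using N_pos unfolding xi by (intro mult_left_mono; linarith)+
  then have "s \<in> cell n (q mod N ^ n)"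
    using e[of "real (q mod N ^ n)"] e[of "real (q mod N ^ n) + 1"]
    unfolding s_def cell_def rq by (simp add: algebra_simps)
  moreover have "fif_L N x (Suc i) s = t"
    using fif_L_eq[of "Suc i" s] \<open>i < N\<close> N_pos by (simp add: s_def)
  ultimately show ?thesis using that unfolding i_def by blast
qed

text \<open>On each piece the function is affine; the sum of all absolute slopes dominates each of
  them and so serves every piece at once.\<close>

lemma fif_h_lipschitz:
  obtains H where "0 \<le> H" "\<And>i s t. i \<in> {1..N} \<Longrightarrow> s \<in> {x (i - 1)..x i} \<Longrightarrow>
    t \<in> {x (i - 1)..x i} \<Longrightarrow> fif_h x y s - fif_h x y t \<le> H * \<bar>s - t\<bar>"
proof
  define g where "g i = (y i - y (i - 1)) / (x i - x (i - 1))" for i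
  define H where "H = (\<Sum>i\<in>{1..N}. \<bar>g i\<bar>)"
  show "0 \<le> H" by (simp add: H_def sum_nonneg)
  fix i s t assume i: "i \<in> {1..N}" and "s \<in> {x (i - 1)..x i}" "t \<in> {x (i - 1)..x i}"
  then have "fif_h x y s - fif_h x y t = (s - t) * g i"
    using fif_h_eq[where N = N and x = x, OF x_less] by (simp only: affine_through_diff g_def)
  also have "\<dots> \<le> \<bar>s - t\<bar> * \<bar>g i\<bar>" by (metis abs_ge_self abs_mult)
  also have "\<dots> \<le> \<bar>s - t\<bar> * H"
    unfolding H_def using i by (intro mult_left_mono member_le_sum) auto
  finally show "fif_h x y s - fif_h x y t \<le> H * \<bar>s - t\<bar>" by (simp add: mult.commute)
qed

lemma fif_b_diff: "fif_b N x y s - fif_b N x y t = (s - t) * ((y N - y 0) / len)"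
  by (simp only: fif_b_def affine_through_diff len_def)

text \<open>Subtract the functional equation at two points of the small cell. The difference of
  \<open>f\<close> at the preimages is multiplied by a value of \<open>\<alpha>\<close>, at most
  \<open>A\<close>; every other term is bounded by a constant times the distance of the points,
  itself at most \<open>len / real N ^ Suc n\<close>.\<close>

lemma osc_Suc:
  obtains C where "0 \<le> C" "\<And>n q. q < N ^ Suc n \<Longrightarrow>
    osc (Suc n) q \<le> A * osc n (q mod N ^ n) + C / real N ^ Suc n"
proof -
  obtain K where K: "K-lipschitz_on {x 0..x N} \<alpha>" using \<alpha>_lipschitz by blast
  have "0 \<le> K" using K by (rule lipschitz_on_nonneg)
  obtain H where H: "0 \<le> H" "\<And>i s t. i \<in> {1..N} \<Longrightarrow> s \<in> {x (i - 1)..x i} \<Longrightarrow>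
    t \<in> {x (i - 1)..x i} \<Longrightarrow> fif_h x y s - fif_h x y t \<le> H * \<bar>s - t\<bar>"
    using fif_h_lipschitz by blast
  have "continuous_on {x 0..x N} (\<lambda>t. f t - fif_b N x y t)"
    unfolding fif_b_def affine_through_def by (intro continuous_intros continuous_f)
  then have "compact ((\<lambda>t. f t - fif_b N x y t) ` {x 0..x N})"
    by (intro compact_continuous_image) auto
  from compact_imp_bounded[OF this]
  obtain B where "\<forall>v\<in>(\<lambda>t. f t - fif_b N x y t) ` {x 0..x N}. norm v \<le> B"
    unfolding bounded_iff by blast
  then have B: "\<bar>f t - fif_b N x y t\<bar> \<le> B" if "t \<in> {x 0..x N}" for t
    using that by simp
  define \<beta> where "\<beta> = \<bar>(y N - y 0) / len\<bar>"
  \<comment> \<open>One summand per error term: \<open>fif_b\<close> is evaluated at preimages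
    \<open>N\<close> times as far apart, the variation of \<open>\<alpha>\<close> multiplies a
    factor bounded by \<open>B\<close>, and \<open>fif_h\<close> has constant \<open>H\<close>. The
    factor \<open>len\<close> comes from the cell width.\<close>
  define C where "C = (real N * \<beta> + K * B + H) * len"
  have "0 \<le> B" using B[of "x 0"] len_pos by (simp add: len_def)
  have "0 \<le> \<beta>" by (simp add: \<beta>_def)
  have "A \<le> 1"
    unfolding sup_norm_on_def using len_pos \<alpha>_range
    by (intro cSUP_least) (force simp: len_def)+
  have C: "0 \<le> C" unfolding C_def
    using \<open>0 \<le> K\<close> \<open>0 \<le> B\<close> \<open>0 \<le> \<beta>\<close> H(1) len_pos by simp
  have "osc (Suc n) q \<le> A * osc n (q mod N ^ n) + C / real N ^ Suc n" if q: "q < N ^ Suc n" for n q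
  proof (rule osc_leI[OF q])
    fix s t assume st: "s \<in> cell (Suc n) q" "t \<in> cell (Suc n) q"
    define i where "i = Suc (q div N ^ n)"
    have i: "i \<in> {1..N}" using q by (simp add: i_def less_mult_imp_div_less Suc_le_eq)
    have qm: "q mod N ^ n < N ^ n" using N_ge_2 by simp
    obtain s' where s': "s' \<in> cell n (q mod N ^ n)" "fif_L N x i s' = s"
      using fif_L_cell[OF q st(1)] i_def by blast
    obtain t' where t': "t' \<in> cell n (q mod N ^ n)" "fif_L N x i t' = t"
      using fif_L_cell[OF q st(2)] i_def by blast
    have in': "s' \<in> {x 0..x N}" "t' \<in> {x 0..x N}" using s' t' cell_subset[OF qm] by auto
    have dom: "s \<in> {x 0..x N}" "t \<in> {x 0..x N}" using st cell_subset[OF q] by auto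
    have L: "s = x (i - 1) + (s' - x 0) / real N" "t = x (i - 1) + (t' - x 0) / real N"
      using s' t' fif_L_eq[OF i] by auto
    have xi: "x i = x (i - 1) + len / real N" using x_step[OF i] by (simp add: len_def)
    have inx: "s \<in> {x (i - 1)..x i}" "t \<in> {x (i - 1)..x i}"
      using in' N_pos unfolding L xi xN_eq by (auto intro!: divide_right_mono)
    have st': "s' - t' = real N * (s - t)" using L N_pos by (simp add: field_simps)
    define d where "d = \<bar>s - t\<bar>"
    have d: "0 \<le> d" "d \<le> len / real N ^ Suc n" using cell_dist[OF st] by (auto simp: d_def)
    have fs: "f s = \<alpha> s * (f s' - fif_b N x y s') + fif_h x y s"
      using f_fif_L[OF i in'(1)] s' by simp
    have ft: "f t = \<alpha> t * (f t' - fif_b N x y t') + fif_h x y t"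
      using f_fif_L[OF i in'(2)] t' by simp
    \<comment> \<open>Adding and subtracting \<open>\<alpha> s\<close> times the factor at
      \<open>t'\<close> isolates the contracting term.\<close>
    have "f s - f t = \<alpha> s * (f s' - f t') - \<alpha> s * (fif_b N x y s' - fif_b N x y t')
        + (\<alpha> s - \<alpha> t) * (f t' - fif_b N x y t') + (fif_h x y s - fif_h x y t)"
      unfolding fs ft by (simp add: algebra_simps)
    moreover have "\<alpha> s * (f s' - f t') \<le> A * osc n (q mod N ^ n)"
    proof -
      have "\<alpha> s * (f s' - f t') \<le> \<alpha> s * osc n (q mod N ^ n)"
        using \<alpha>_range[OF dom(1)] abs_diff_le_osc[OF qm s'(1) t'(1)] by (intro mult_left_mono) auto
      also have "\<dots> \<le> A * osc n (q mod N ^ n)"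
        using \<alpha>_le_A[OF dom(1)] osc_nonneg[OF qm] by (rule mult_right_mono)
      finally show ?thesis .
    qed
    moreover have "- (\<alpha> s * (fif_b N x y s' - fif_b N x y t')) \<le> 1 * (real N * \<beta> * d)"
    proof -
      have "\<bar>fif_b N x y s' - fif_b N x y t'\<bar> = real N * \<beta> * d"
        unfolding fif_b_diff st' by (simp add: abs_mult \<beta>_def d_def)
      then have "\<bar>\<alpha> s * (fif_b N x y s' - fif_b N x y t')\<bar> \<le> 1 * (real N * \<beta> * d)"
        unfolding abs_mult using \<alpha>_range[OF dom(1)] by (intro mult_mono) auto
      then show ?thesis by linarith
    qed
    moreover have "(\<alpha> s - \<alpha> t) * (f t' - fif_b N x y t') \<le> (K * d) * B"
    proof -
      have "\<bar>\<alpha> s - \<alpha> t\<bar> \<le> K * d"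
        using lipschitz_onD[OF K dom] by (simp add: dist_real_def d_def)
      then have "\<bar>(\<alpha> s - \<alpha> t) * (f t' - fif_b N x y t')\<bar> \<le> (K * d) * B"
        unfolding abs_mult using B[OF in'(2)] \<open>0 \<le> K\<close> d(1) by (intro mult_mono) auto
      then show ?thesis by linarith
    qed
    moreover have "fif_h x y s - fif_h x y t \<le> H * d"
      unfolding d_def using H(2)[OF i inx] .
    ultimately have "f s - f t \<le> A * osc n (q mod N ^ n) + (real N * \<beta> + K * B + H) * d"
      by (simp add: algebra_simps)
    moreover have "(real N * \<beta> + K * B + H) * d \<le> (real N * \<beta> + K * B + H) * (len / real N ^ Suc n)"
      using \<open>0 \<le> K\<close> \<open>0 \<le> B\<close> \<open>0 \<le> \<beta>\<close> H(1) d(2) by (intro mult_left_mono) auto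
    ultimately show "f s - f t \<le> A * osc n (q mod N ^ n) + C / real N ^ Suc n"
      by (simp add: C_def)
  qed
  with C that show ?thesis by blast
qed

text \<open>Multiplied by the power of \<open>N\<close> of its level, the recursion of
  \<open>osc_Suc\<close> takes the form \<open>v' \<le> (N A) v + C\<close>, whose iteration leaves
  a geometric sum. Each application removes one leading digit, so \<open>m\<close> of them leave
  \<open>q mod N ^ k\<close>.\<close>

lemma osc_iterate:
  obtains C where "0 \<le> C" "\<And>m k q. q < N ^ (m + k) \<Longrightarrow> real N ^ (m + k) * osc (m + k) q \<le>
    (real N * A) ^ m * (real N ^ k * osc k (q mod N ^ k)) + C * (\<Sum>i<m. (real N * A) ^ i)"
proof -
  obtain C where C: "0 \<le> C" "\<And>n q. q < N ^ Suc n \<Longrightarrow>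
    osc (Suc n) q \<le> A * osc n (q mod N ^ n) + C / real N ^ Suc n"
    using osc_Suc by blast
  have "real N ^ (m + k) * osc (m + k) q \<le>
    (real N * A) ^ m * (real N ^ k * osc k (q mod N ^ k)) + C * (\<Sum>i<m. (real N * A) ^ i)"
    if "q < N ^ (m + k)" for m k q
    using that
  proof (induction m arbitrary: q)
    case 0
    then show ?case by simp
  next
    case (Suc m)
    define q' where "q' = q mod N ^ (m + k)"
    have q': "q' < N ^ (m + k)" using N_ge_2 by (simp add: q'_def)
    have mod: "q' mod N ^ k = q mod N ^ k"
      unfolding q'_def by (rule mod_mod_cancel) (simp add: power_add)
    have "osc (Suc (m + k)) q \<le> A * osc (m + k) q' + C / real N ^ Suc (m + k)"
      using C(2)[of q "m + k"] Suc.prems by (simp add: q'_def)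
    then have "real N ^ Suc (m + k) * osc (Suc (m + k)) q
        \<le> real N ^ Suc (m + k) * (A * osc (m + k) q' + C / real N ^ Suc (m + k))"
      by (rule mult_left_mono) simp
    also have "\<dots> = (real N * A) * (real N ^ (m + k) * osc (m + k) q') + C"
      using N_pos by (simp add: distrib_left)
    also have "\<dots> \<le> (real N * A) * ((real N * A) ^ m * (real N ^ k * osc k (q' mod N ^ k))
        + C * (\<Sum>i<m. (real N * A) ^ i)) + C"
      using Suc.IH[OF q'] N_pos A_pos by (intro add_right_mono mult_left_mono) auto
    also have "\<dots> = (real N * A) ^ Suc m * (real N ^ k * osc k (q' mod N ^ k))
        + C * (\<Sum>i<Suc m. (real N * A) ^ i)"
      unfolding sum.lessThan_Suc_shift
      by (simp add: distrib_left sum_distrib_left mult_ac)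
    finally show ?case by (simp add: mod)
  qed
  with C(1) that show ?thesis by blast
qed

subsection \<open>Coverings and mesh counts of the graph\<close>

text \<open>The size of the graph at scale \<open>N^-k\<close>, estimated column by column:
  \<open>coverable_cell\<close> bounds a covering over one cell by a multiple of one summand, and
  \<open>weight_le_mesh_count\<close> bounds the sum by a mesh count.\<close>

definition weight :: "nat \<Rightarrow> real" where
  "weight k = (\<Sum>j<N ^ k. 1 + real N ^ k * osc k j)"

lemma weight_nonneg: "0 \<le> weight k"
  unfolding weight_def by (intro sum_nonneg) (simp add: osc_nonneg)

text \<open>The graph over the cell lies in a box of width \<open>len / real N ^ n\<close> and
  height \<open>osc n j\<close>. Since \<open>1 / r \<le> real N ^ n\<close>, the factors of
  \<open>coverable_box\<close> are at most \<open>2 * len + 1\<close> and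
  \<open>2 * (1 + real N ^ n * osc n j)\<close>.\<close>

lemma coverable_cell:
  assumes j: "j < N ^ n" and r: "1 \<le> real N ^ n * r"
  shows "coverable r (graph_on (cell n j) f) ((4 * len + 2) * (1 + real N ^ n * osc n j))"
proof -
  have N: "0 < real N ^ n" using N_pos by simp
  then have "0 < r" using r by (metis less_le_trans zero_less_mult_pos zero_less_one)
  obtain a where a: "f ` cell n j = {a..a + osc n j}" "0 \<le> osc n j"
    using f_image_cell[OF j] .
  define u where "u = x 0 + real j * len / real N ^ n"
  define w where "w = len / real N ^ n"
  have w: "0 \<le> w" using len_pos by (simp add: w_def)
  have "cell n j = {u..u + w}"
    by (simp add: cell_def u_def w_def distrib_right add_divide_distrib)
  then have sub: "graph_on (cell n j) f \<subseteq> {u..u + w} \<times> {a..a + osc n j}"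
    using a(1) unfolding graph_on_def by auto
  have inv: "1 / r \<le> real N ^ n" using r \<open>0 < r\<close> by (simp add: divide_le_eq)
  have "w / r \<le> len"
  proof -
    have "w / r = w * (1 / r)" by simp
    also have "\<dots> \<le> w * real N ^ n" by (rule mult_left_mono[OF inv w])
    also have "\<dots> = len" using N by (simp add: w_def)
    finally show ?thesis .
  qed
  moreover have "osc n j / r \<le> real N ^ n * osc n j"
    using mult_left_mono[OF inv a(2)] by (simp add: mult.commute)
  moreover have "0 \<le> real N ^ n * osc n j" using a(2) by simp
  ultimately have "(2 * w / r + 1) * (2 * osc n j / r + 1) \<le>
      (2 * len + 1) * (2 * (1 + real N ^ n * osc n j))"
    using len_pos a(2) \<open>0 < r\<close> by (intro mult_mono) auto
  also have "\<dots> = (4 * len + 2) * (1 + real N ^ n * osc n j)" by (simp add: algebra_simps)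
  finally show ?thesis
    using \<open>0 < r\<close> w a(2) by (intro coverable_mono[OF coverable_box sub])
qed

lemma cell_subset_UN:
  assumes "t \<in> cell m p"
  obtains j where "j < N ^ k" "t \<in> cell (m + k) (p * N ^ k + j)"
proof -
  define M where "M = real N ^ m"
  define K where "K = real N ^ k"
  define w where "w = len / (M * K)"
  have MK: "0 < M" "0 < K" using N_pos by (auto simp: M_def K_def)
  then have w: "0 < w" using len_pos by (simp add: w_def)
  have len_eq: "len / M = K * w" using MK by (simp add: w_def)
  have t: "x 0 + real p * (K * w) \<le> t" "t \<le> x 0 + (real p + 1) * (K * w)"
    using assms unfolding cell_def M_def[symmetric]
    by (simp_all add: times_divide_eq_right[symmetric] len_eq del: times_divide_eq_right)
  define u where "u = (t - x 0) / w - real p * K"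
  have tu: "t = x 0 + (real p * K + u) * w" using w by (simp add: u_def)
  have "real p * K * w \<le> (real p * K + u) * w" "(real p * K + u) * w \<le> (real p + 1) * K * w"
    using t unfolding tu by (simp_all add: mult.assoc)
  then have u: "0 \<le> u" "u \<le> K"
    using w by (simp_all add: distrib_right zero_le_mult_iff)
  have cell_eq: "cell (m + k) q = {x 0 + real q * w..x 0 + (real q + 1) * w}" for q
    by (simp add: cell_def w_def M_def K_def power_add)
  have mem: "t \<in> cell (m + k) (p * N ^ k + j)" if "real j \<le> u" "u \<le> real j + 1" for j
    unfolding cell_eq using that w by (auto simp: tu K_def add.assoc)
  show ?thesis
  proof (cases "u < K")
    case True
    moreover have fl: "real (nat \<lfloor>u\<rfloor>) \<le> u" "u \<le> real (nat \<lfloor>u\<rfloor>) + 1" using u by linarith+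
    moreover have "K = real (N ^ k)" by (simp add: K_def)
    ultimately have "real (nat \<lfloor>u\<rfloor>) < real (N ^ k)" by linarith
    then have "nat \<lfloor>u\<rfloor> < N ^ k" by (simp only: of_nat_less_iff)
    then show ?thesis using that mem[OF fl] by blast
  next
    case False
    \<comment> \<open>Here \<open>t\<close> is the right end of the cell, where the floor of
      \<open>u\<close> would be the index \<open>N ^ k\<close>, out of range; the last subcell
      contains \<open>t\<close>.\<close>
    have "1 \<le> N ^ k" using N_ge_2 by simp
    then have "real (N ^ k - 1) = K - 1" by (simp add: K_def)
    then show ?thesis using that[of "N ^ k - 1"] mem[of "N ^ k - 1"] u False \<open>1 \<le> N ^ k\<close> by simp
  qed
qed

lemma index_less:
  assumes "p < N ^ m" "j < N ^ k"
  shows "p * N ^ k + j < N ^ (m + k)"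
proof -
  have "p * N ^ k + j < Suc p * N ^ k" using assms by simp
  also have "\<dots> \<le> N ^ m * N ^ k" using assms by (intro mult_right_mono) auto
  finally show ?thesis by (simp add: power_add)
qed

text \<open>The ball projects into an interval of length \<open>2 * R\<close>, which meets at most
  \<open>2 / len + 2\<close> cells of level \<open>m\<close> wherever it lies; \<open>T\<close>
  controls the cost over each of them uniformly.\<close>

lemma coverable_ball_graph:
  assumes R: "0 \<le> R" "real N ^ m * R \<le> 1" and r: "1 \<le> real N ^ (m + k) * r"
    and T: "\<And>p. p < N ^ m \<Longrightarrow>
      (\<Sum>j<N ^ k. 1 + real N ^ (m + k) * osc (m + k) (p * N ^ k + j)) \<le> T"
  shows "coverable r (ball z R \<inter> \<Gamma>) ((2 / len + 2) * ((4 * len + 2) * T))"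
proof -
  define w where "w = len / real N ^ m"
  have w: "0 < w" using len_pos N_pos by (simp add: w_def)
  have cell_eq: "cell m p = {x 0 + real p * w..x 0 + (real p + 1) * w}" for p
    by (simp add: cell_def w_def)
  define P where "P = {p. p < N ^ m \<and> cell m p \<inter> {fst z - R..fst z + R} \<noteq> {}}"
  have "finite P" by (simp add: P_def)
  have cov: "coverable r (\<Union>p\<in>P. \<Union>j<N ^ k. graph_on (cell (m + k) (p * N ^ k + j)) f)
    (\<Sum>p\<in>P. \<Sum>j<N ^ k. (4 * len + 2) * (1 + real N ^ (m + k) * osc (m + k) (p * N ^ k + j)))"
    by (intro coverable_UN \<open>finite P\<close> finite_lessThan coverable_cell r index_less) (auto simp: P_def)
  have sub: "ball z R \<inter> \<Gamma> \<subseteq> (\<Union>p\<in>P. \<Union>j<N ^ k. graph_on (cell (m + k) (p * N ^ k + j)) f)"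
  proof
    fix q assume q: "q \<in> ball z R \<inter> \<Gamma>"
    then obtain t where t: "t \<in> {x 0..x N}" "q = (t, f t)" by (auto simp: graph_on_def)
    obtain p where p: "p < N ^ m" "t \<in> cell m p"
      using cell_subset_UN[of t 0 0 m] t(1) cell_0 by auto
    have "t \<in> {fst z - R..fst z + R}"
      using q t(2) ball_Pair_subset_box[of z R] by auto
    then have "p \<in> P" using p by (auto simp: P_def)
    moreover obtain j where "j < N ^ k" "t \<in> cell (m + k) (p * N ^ k + j)"
      using cell_subset_UN[OF p(2)] .
    ultimately show "q \<in> (\<Union>p\<in>P. \<Union>j<N ^ k. graph_on (cell (m + k) (p * N ^ k + j)) f)"
      unfolding graph_on_def t(2) by blast
  qed
  have "real (card P) \<le> 2 / len + 2"
  proof -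
    \<comment> \<open>Index bounds for cells meeting the interval: the left edge is at most
      \<open>fst z + R\<close> and the right edge, at index \<open>p + 1\<close>, at least
      \<open>fst z - R\<close>; hence the \<open>- 1\<close>.\<close>
    define a where "a = (fst z - R - x 0) / w - 1"
    define b where "b = (fst z + R - x 0) / w"
    have ab: "b - a = 2 * R / w + 1"
      by (simp add: a_def b_def diff_divide_distrib add_divide_distrib)
    have "real (card P) \<le> b - a + 1"
    proof (rule card_nat_interval_le)
      fix p assume "p \<in> P"
      then obtain t where "t \<in> cell m p" "t \<in> {fst z - R..fst z + R}"
        unfolding P_def by blast
      then have "real p * w \<le> fst z + R - x 0" "fst z - R - x 0 \<le> (real p + 1) * w"
        unfolding cell_eq by auto
      then have "real p \<le> b" "(fst z - R - x 0) / w \<le> real p + 1"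
        unfolding b_def using w by (simp_all only: pos_le_divide_eq pos_divide_le_eq)
      then show "a \<le> real p \<and> real p \<le> b" by (simp add: a_def)
    next
      have "0 \<le> 2 * R / w" using R(1) w by simp
      then show "a \<le> b" using ab by linarith
    qed
    also have "R / w = real N ^ m * R / len" by (simp add: w_def)
    then have "2 * R / w \<le> 2 / len"
      using divide_right_mono[OF R(2), of len] len_pos by simp
    then have "b - a + 1 \<le> 2 / len + 2" using ab by linarith
    finally show ?thesis .
  qed
  moreover have "0 \<le> T"
  proof -
    have "0 \<le> (\<Sum>j<N ^ k. 1 + real N ^ (m + k) * osc (m + k) (0 * N ^ k + j))"
      using index_less[of 0 m _ k] N_ge_2 by (intro sum_nonneg add_nonneg_nonneg mult_nonneg_nonneg osc_nonneg) auto
    also have "\<dots> \<le> T" using T[of 0] N_ge_2 by simp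
    finally show ?thesis .
  qed
  ultimately have "real (card P) * ((4 * len + 2) * T) \<le> (2 / len + 2) * ((4 * len + 2) * T)"
    using len_pos by (intro mult_right_mono) auto
  moreover have "(\<Sum>p\<in>P. \<Sum>j<N ^ k. (4 * len + 2) * (1 + real N ^ (m + k) * osc (m + k) (p * N ^ k + j)))
      \<le> (\<Sum>p\<in>P. (4 * len + 2) * T)"
    unfolding sum_distrib_left[symmetric] using len_pos T
    by (intro sum_mono mult_left_mono) (auto simp: P_def)
  ultimately show ?thesis
    by (intro coverable_mono[OF cov sub]) simp
qed

lemma bounded_graph: "bounded \<Gamma>" and connected_graph: "connected \<Gamma>"
proof -
  have "continuous_on {x 0..x N} (\<lambda>t. (t, f t))"
    by (intro continuous_intros continuous_f)
  then show "bounded \<Gamma>" "connected \<Gamma>"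
    unfolding graph_on_def
    by (auto intro!: compact_imp_bounded compact_continuous_image connected_continuous_image)
qed

text \<open>The mesh width equals the cell width. Comparing one summand with the squares over its
  cell costs 2, from \<open>mesh_column_count\<close>, and \<open>1 + len\<close>, because
  \<open>real N ^ k\<close> is \<open>len / \<delta>\<close>; a square is counted for at most five
  cells.\<close>

lemma weight_le_mesh_count:
  "weight k \<le> 10 * (1 + len) * real (mesh_count \<Gamma> (len / real N ^ k))"
proof -
  define \<delta> where "\<delta> = len / real N ^ k"
  have \<delta>: "0 < \<delta>" using len_pos N_pos by (simp add: \<delta>_def)
  define Q where "Q = {m. mesh_square \<delta> m \<inter> \<Gamma> \<noteq> {}}"
  define Q' where "Q' j = {m. mesh_square \<delta> m \<inter> graph_on (cell k j) f \<noteq> {}}" for j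
  have "finite Q" unfolding Q_def by (rule finite_mesh_squares[OF bounded_graph \<delta>])
  have Q': "Q' j \<subseteq> Q" if "j < N ^ k" for j
    using cell_subset[OF that] unfolding Q_def Q'_def graph_on_def by blast
  have fin: "finite (Q' j)" if "j < N ^ k" for j
    using finite_subset[OF Q'[OF that] \<open>finite Q\<close>] .
  have "1 + real N ^ k * osc k j \<le> (1 + len) * (2 * real (card (Q' j)))" if j: "j < N ^ k" for j
  proof -
    obtain a where a: "f ` cell k j = {a..a + osc k j}" "0 \<le> osc k j"
      using f_image_cell[OF j] .
    have "1 + (a + osc k j - a) / \<delta> \<le> 2 * real (card (Q' j))"
      unfolding Q'_def by (rule mesh_column_count[OF \<delta> a(1)]) (use a fin[OF j] Q'_def in auto)
    then have "(1 + len) * (1 + osc k j / \<delta>) \<le> (1 + len) * (2 * real (card (Q' j)))"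
      using len_pos by (intro mult_left_mono) auto
    moreover have "len * (osc k j / \<delta>) = real N ^ k * osc k j"
      using len_pos by (simp add: \<delta>_def)
    moreover have "(1 + len) * (1 + osc k j / \<delta>) = 1 + len + osc k j / \<delta> + len * (osc k j / \<delta>)"
      by (simp only: distrib_left distrib_right mult_1 mult_1_right add.assoc)
    moreover have "0 \<le> osc k j / \<delta>" using a(2) \<delta> by simp
    ultimately show ?thesis using len_pos by linarith
  qed
  then have "weight k \<le> (\<Sum>j<N ^ k. (1 + len) * (2 * real (card (Q' j))))"
    unfolding weight_def by (intro sum_mono) auto
  also have "\<dots> = (1 + len) * 2 * real (\<Sum>j<N ^ k. card (Q' j))"
    by (simp only: sum_distrib_left[symmetric] of_nat_sum mult.assoc)
  also have "(\<Sum>j<N ^ k. card (Q' j)) = card (SIGMA j:{..<N ^ k}. Q' j)"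
    using fin by (intro card_SigmaI[symmetric]) auto
  also have "(1 + len) * 2 * real (card (SIGMA j:{..<N ^ k}. Q' j)) \<le> (1 + len) * 2 * real (5 * card Q)"
  proof -
    \<comment> \<open>Each mesh square meets at most five columns: record a square together with the offset of the column.\<close>
    define c where "c = \<lfloor>x 0 / \<delta>\<rfloor>"
    define g where "g = (\<lambda>(j, m :: int \<times> int). (m, int j - fst m + c))"
    have "inj_on g (SIGMA j:{..<N ^ k}. Q' j)"
      unfolding g_def inj_on_def by auto
    moreover have "g ` (SIGMA j:{..<N ^ k}. Q' j) \<subseteq> Q \<times> {-2..2}"
    proof (rule image_subsetI)
      fix jm assume "jm \<in> (SIGMA j:{..<N ^ k}. Q' j)"
      then obtain j m1 m2 where jm: "jm = (j, m1, m2)"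
        and j: "j \<in> {..<N ^ k}" and m: "(m1, m2) \<in> Q' j"
        by auto
      obtain t where t: "t \<in> cell k j" "(t, f t) \<in> mesh_square \<delta> (m1, m2)"
        using m unfolding Q'_def graph_on_def by auto
      have t1: "x 0 + real j * \<delta> \<le> t" "t \<le> x 0 + (real j + 1) * \<delta>"
        using t(1) by (auto simp: cell_def \<delta>_def)
      have t2: "of_int m1 * \<delta> \<le> t" "t \<le> (of_int m1 + 1) * \<delta>"
        using t(2) by (auto simp: mesh_square_def)
      have "of_int c \<le> x 0 / \<delta>" "x 0 / \<delta> < of_int c + 1" unfolding c_def by linarith+
      then have c: "of_int c * \<delta> \<le> x 0" "x 0 < (of_int c + 1) * \<delta>"
        using \<delta> by (simp_all only: pos_le_divide_eq pos_divide_less_eq)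
      have "of_int (c + int j) * \<delta> \<le> of_int (m1 + 1) * \<delta>" "of_int m1 * \<delta> < of_int (c + int j + 2) * \<delta>"
        using t1 t2 c by (simp_all add: distrib_right)
      then have "c + int j \<le> m1 + 1" "m1 < c + int j + 2"
        using \<delta> by (simp_all only: mult_le_cancel_right_pos mult_less_cancel_right_pos of_int_le_iff of_int_less_iff)
      then have "int j - m1 + c \<in> {-2..2}" by auto
      then show "g jm \<in> Q \<times> {-2..2}"
        using m Q'[of j] j by (auto simp: g_def jm)
    qed
    ultimately have "card (SIGMA j:{..<N ^ k}. Q' j) \<le> card (Q \<times> {-2..2::int})"
      using \<open>finite Q\<close> by (intro card_inj_on_le) auto
    also have "\<dots> = 5 * card Q" by (simp add: card_cartesian_product)
    finally show ?thesis using len_pos by (intro mult_left_mono) auto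
  qed
  finally show ?thesis by (simp add: mesh_count_def Q_def \<delta>_def algebra_simps)
qed

subsection \<open>Bounds on the spectrum\<close>

text \<open>Makes every real exponent above the upper box dimension positive and excludes the value
  minus infinity.\<close>

lemma upper_box_dim_nonneg: "0 \<le> upper_box_dim \<Gamma>"
proof -
  have "eventually (\<lambda>\<epsilon>::real. \<epsilon> \<in> {0<..<1}) (at_right 0)"
    by (rule eventually_at_right_real) simp
  then have "eventually (\<lambda>\<epsilon>. 0 \<le> ereal (ln (real (mesh_count \<Gamma> \<epsilon>)) / ln (1 / \<epsilon>))) (at_right 0)"
  proof eventually_elim
    case (elim \<epsilon>)
    have "0 \<le> ln (real (mesh_count \<Gamma> \<epsilon>))"
      by (cases "mesh_count \<Gamma> \<epsilon>") auto
    moreover have "0 \<le> ln (1 / \<epsilon>)" using elim by (intro ln_ge_zero) auto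
    ultimately show ?case by simp
  qed
  then show ?thesis
    unfolding upper_box_dim_def by (intro le_Limsup) auto
qed

text \<open>The upper limit, read along the scales \<open>len / real N ^ k\<close>, bounds the mesh
  counts for all large \<open>k\<close>; the finitely many remaining \<open>k\<close> are absorbed
  into the constant.\<close>

lemma weight_le_powr:
  assumes "upper_box_dim \<Gamma> < ereal s"
  obtains C where "0 < C" "\<And>k. weight k \<le> C * (real N ^ k) powr s"
proof -
  have ev: "eventually (\<lambda>\<epsilon>. ereal (ln (real (mesh_count \<Gamma> \<epsilon>)) / ln (1 / \<epsilon>)) < ereal s) (at_right 0)"
    using assms unfolding upper_box_dim_def by (rule Limsup_lessD)
  have lim0: "(\<lambda>k. len / real N ^ k) \<longlonglongrightarrow> 0"
    using N_gt_1 by (rule LIMSEQ_divide_realpow_zero)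
  have lim: "filterlim (\<lambda>k. len / real N ^ k) (at_right 0) sequentially"
    unfolding filterlim_at using lim0 len_pos N_pos by (auto intro!: always_eventually)
  have ev1: "eventually (\<lambda>k. ereal (ln (real (mesh_count \<Gamma> (len / real N ^ k)))
      / ln (1 / (len / real N ^ k))) < ereal s) sequentially"
    by (rule eventually_compose_filterlim[OF ev lim])
  have ev2: "eventually (\<lambda>k. len / real N ^ k < 1) sequentially"
    using lim0 by (rule order_tendstoD) simp
  define c where "c = 10 * (1 + len) * len powr - s"
  have "0 < c" using len_pos by (simp add: c_def)
  have "eventually (\<lambda>k. weight k \<le> c * (real N ^ k) powr s) sequentially"
    using ev1 ev2
  proof eventually_elim
    case (elim k)
    define \<delta> where "\<delta> = len / real N ^ k"
    have \<delta>: "0 < \<delta>" "\<delta> < 1" using elim(2) len_pos N_pos by (auto simp: \<delta>_def)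
    define M where "M = real (mesh_count \<Gamma> \<delta>)"
    have "0 < ln (1 / \<delta>)" using \<delta> by (intro ln_gt_zero) auto
    then have "ln M < s * ln (1 / \<delta>)"
      using elim(1) by (simp add: M_def \<delta>_def divide_less_eq)
    then have "exp (ln M) \<le> exp (s * ln (1 / \<delta>))" by simp
    moreover have "M \<le> exp (ln M)" by (cases "0 < M") (auto simp: M_def)
    moreover have "exp (s * ln (1 / \<delta>)) = (1 / \<delta>) powr s" using \<delta> by (simp add: powr_def)
    moreover have "(1 / \<delta>) powr s = len powr - s * (real N ^ k) powr s"
      using len_pos N_pos by (simp add: \<delta>_def powr_divide powr_minus_divide)
    ultimately have "M \<le> len powr - s * (real N ^ k) powr s" by linarith
    then have "10 * (1 + len) * M \<le> 10 * (1 + len) * (len powr - s * (real N ^ k) powr s)"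
      using len_pos by (intro mult_left_mono) auto
    then show ?case
      using weight_le_mesh_count[of k] by (simp add: M_def \<delta>_def c_def mult.assoc)
  qed
  then obtain k0 where k0: "\<And>k. k0 \<le> k \<Longrightarrow> weight k \<le> c * (real N ^ k) powr s"
    unfolding eventually_sequentially by blast
  define g where "g k = weight k / (real N ^ k) powr s" for k
  define C where "C = c + (\<Sum>k<k0. g k)"
  have g: "0 \<le> g k" for k using weight_nonneg[of k] by (simp add: g_def)
  then have "0 < C" using \<open>0 < c\<close> by (simp add: C_def add_pos_nonneg sum_nonneg)
  moreover have "weight k \<le> C * (real N ^ k) powr s" for k
  proof -
    have pos: "0 < (real N ^ k) powr s" using N_pos by simp
    have "g k \<le> C"
    proof (cases "k0 \<le> k")
      case True
      then have "g k \<le> c" using k0[of k] pos by (simp add: g_def divide_le_eq)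
      moreover have "0 \<le> (\<Sum>k<k0. g k)" using g by (intro sum_nonneg)
      ultimately show ?thesis by (simp add: C_def)
    next
      case False
      then have "g k \<le> (\<Sum>k<k0. g k)" using g by (intro member_le_sum) auto
      then show ?thesis using \<open>0 < c\<close> by (simp add: C_def)
    qed
    then show ?thesis using pos by (simp add: g_def divide_le_eq)
  qed
  ultimately show ?thesis using that by blast
qed

text \<open>\<open>m\<close> is the last exponent with \<open>real N ^ m \<le> 1 / R\<close>, and
  \<open>m + k\<close> the first whose power exceeds \<open>1 / r\<close>; rounding up there makes
  the fine scale at most \<open>r\<close>. Each rounding costs a factor \<open>N\<close>, hence
  \<open>(real N)\<^sup>2\<close>.\<close>

lemma scales:
  assumes "0 < r" "r < R" "R < 1"
  obtains m k where "real N ^ m * R \<le> 1" "1 \<le> real N ^ (m + k) * r"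
    "real N ^ k \<le> (real N)\<^sup>2 * (R / r)" "real N ^ (m + k) * r \<le> real N"
proof -
  obtain m where m: "real N ^ m \<le> 1 / R" "1 / R < real N ^ Suc m"
    using ex_power_between[OF N_gt_1, of "1 / R"] assms by auto
  obtain l where l: "real N ^ l \<le> 1 / r" "1 / r < real N ^ Suc l"
    using ex_power_between[OF N_gt_1, of "1 / r"] assms by auto
  have "1 / R < 1 / r" using assms by (simp add: frac_less2)
  then have "real N ^ m < real N ^ Suc l" using m(1) l(2) by linarith
  then have "m < Suc l" using N_gt_1 by (simp only: power_strict_increasing_iff)
  then obtain k where k: "Suc l = m + k" using le_Suc_ex[of m "Suc l"] by auto
  have m': "real N ^ m * R \<le> 1" "1 \<le> real N ^ Suc m * R"
    using m assms by (simp_all add: field_simps)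
  have "1 \<le> real N ^ Suc l * r" "real N ^ l * r \<le> 1"
    using l assms by (simp_all add: field_simps)
  then have l': "1 \<le> real N ^ (m + k) * r" "real N ^ (m + k) * r \<le> real N"
    unfolding k[symmetric] using mult_left_mono[of "real N ^ l * r" 1 "real N"]
    by (simp_all add: mult.assoc)
  have "real N ^ k * r \<le> real N ^ k * r * (real N ^ Suc m * R)"
    using mult_left_mono[OF m'(2), of "real N ^ k * r"] assms N_pos by simp
  also have "\<dots> = (real N ^ (m + k) * r) * (real N * R)" by (simp add: power_add)
  also have "\<dots> \<le> real N * (real N * R)"
    using l'(2) assms by (intro mult_right_mono) auto
  finally have "real N ^ k \<le> (real N)\<^sup>2 * (R / r)"
    using assms by (simp add: power2_eq_square pos_le_divide_eq mult.assoc)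
  with m' l' that show ?thesis by blast
qed

text \<open>The level \<open>m + k\<close> is bounded by a constant plus a multiple of
  \<open>ln (R / r)\<close>, which every positive power of \<open>R / r\<close> dominates; so each
  exponent \<open>1 + e\<close> is admissible.\<close>

lemma assouad_spectrum_le_1:
  assumes \<theta>: "\<theta> \<in> {0<..<1}" and NA: "real N * A \<le> 1"
  shows "assouad_spectrum \<theta> \<Gamma> \<le> 1"
proof (rule ereal_le_epsilon2)
  fix e :: real assume "0 < e"
  obtain C where C: "0 \<le> C" "\<And>m k q. q < N ^ (m + k) \<Longrightarrow> real N ^ (m + k) * osc (m + k) q \<le>
    (real N * A) ^ m * (real N ^ k * osc k (q mod N ^ k)) + C * (\<Sum>i<m. (real N * A) ^ i)"
    using osc_iterate by blast
  define B where "B = 1 + osc 0 0"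
  have "1 \<le> B" using osc_nonneg[of 0 0] by (simp add: B_def)
  \<comment> \<open>Iterating from level 0, the geometric sum has terms at most 1, so the growth is
    linear in the level.\<close>
  have osc_le: "1 + real N ^ n * osc n q \<le> B + C * real n" if q: "q < N ^ n" for n q
  proof -
    have a: "0 \<le> real N * A" using A_pos by simp
    have "(real N * A) ^ n * osc 0 0 \<le> osc 0 0"
      using NA a osc_nonneg[of 0 0] by (intro mult_left_le_one_le) (auto intro: power_le_one)
    moreover have "(\<Sum>i<n. (real N * A) ^ i) \<le> (\<Sum>i<n. 1)"
      using NA a by (intro sum_mono power_le_one)
    then have "C * (\<Sum>i<n. (real N * A) ^ i) \<le> C * real n"
      using C(1) by (intro mult_left_mono) auto
    ultimately show ?thesis using C(2)[of q n 0] q by (simp add: B_def)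
  qed
  \<comment> \<open>Comes from \<open>ln z \<le> z powr e / e\<close> and
    \<open>- ln r = ln z / (1 - \<theta>)\<close>, so that \<open>m + k\<close> is at most
    \<open>L * z powr e\<close>.\<close>
  define L where "L = 1 + 1 / (e * (1 - \<theta>) * ln (real N))"
  define c where "c = (2 / len + 2) * (4 * len + 2) * (real N)\<^sup>2 * (B + C * L)"
  have lnN: "0 < ln (real N)" using N_gt_1 by simp
  have "0 \<le> L" using \<open>0 < e\<close> \<theta> lnN by (simp add: L_def)
  have "0 < c" unfolding c_def
    using len_pos N_pos \<open>1 \<le> B\<close> C(1) \<open>0 \<le> L\<close> by (intro mult_pos_pos add_pos_nonneg) auto
  have "assouad_spectrum \<theta> \<Gamma> \<le> ereal (1 + e)"
  proof (rule assouad_spectrum_leI[OF \<open>0 < c\<close>])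
    fix R :: real and p assume R: "0 < R" "R < 1"
    define r where "r = R powr (1 / \<theta>)"
    have r: "0 < r" "r < R" using powr_inverse_le[OF R \<theta>] by (auto simp: r_def)
    define z where "z = R / r"
    have z: "1 \<le> z" using r by (simp add: z_def)
    obtain m k where mk: "real N ^ m * R \<le> 1" "1 \<le> real N ^ (m + k) * r"
      "real N ^ k \<le> (real N)\<^sup>2 * z" "real N ^ (m + k) * r \<le> real N"
      using scales[OF r R(2)] z_def by blast
    have n: "real (m + k) \<le> L * z powr e"
    proof -
      have "ln r = ln R / \<theta>" using R by (simp add: r_def)
      \<comment> \<open>Since \<open>R = r powr \<theta>\<close>, the ratio \<open>z\<close> is
        \<open>r powr (\<theta> - 1)\<close>.\<close>
      then have "ln z = - ln r * (1 - \<theta>)"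
        using r R \<theta> by (simp add: z_def ln_div field_simps)
      then have lnr: "- ln r = ln z / (1 - \<theta>)" using \<theta> by (simp add: field_simps)
      have "ln (real N ^ (m + k) * r) \<le> ln (real N)"
        using mk(4) r N_pos by (subst ln_le_cancel_iff) auto
      then have "real (m + k) * ln (real N) \<le> ln (real N) + ln z / (1 - \<theta>)"
        using r N_pos lnr by (simp add: ln_mult ln_realpow)
      then have "real (m + k) \<le> (ln (real N) + ln z / (1 - \<theta>)) / ln (real N)"
        using lnN by (simp only: pos_le_divide_eq)
      also have "\<dots> = 1 + ln z / (1 - \<theta>) / ln (real N)"
        using lnN by (simp add: add_divide_distrib)
      also have "ln z / (1 - \<theta>) / ln (real N) \<le> z powr e / e / (1 - \<theta>) / ln (real N)"
        using ln_powr_bound[OF z \<open>0 < e\<close>] \<theta> lnN by (intro divide_right_mono) auto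
      also have "1 + z powr e / e / (1 - \<theta>) / ln (real N) \<le> L * z powr e"
        using ge_one_powr_ge_zero[OF z, of e] \<open>0 < e\<close> by (simp add: L_def distrib_right mult.assoc)
      finally show ?thesis by simp
    qed
    have Bz: "B + C * real (m + k) \<le> (B + C * L) * z powr e"
    proof -
      have "B * 1 \<le> B * z powr e"
        using ge_one_powr_ge_zero[OF z, of e] \<open>0 < e\<close> \<open>1 \<le> B\<close> by (intro mult_left_mono) auto
      moreover have "C * real (m + k) \<le> C * (L * z powr e)"
        using n C(1) by (rule mult_left_mono)
      ultimately show ?thesis by (simp add: distrib_right)
    qed
    define T where "T = real N ^ k * (B + C * real (m + k))"
    have "coverable r (ball p R \<inter> \<Gamma>) ((2 / len + 2) * ((4 * len + 2) * T))"
    proof (rule coverable_ball_graph[OF less_imp_le[OF R(1)] mk(1,2)])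
      fix p assume p: "p < N ^ m"
      have "p * N ^ k + j < N ^ (m + k)" if "j < N ^ k" for j
        using index_less[OF p that] .
      then have "(\<Sum>j<N ^ k. 1 + real N ^ (m + k) * osc (m + k) (p * N ^ k + j))
          \<le> (\<Sum>j<N ^ k. B + C * real (m + k))"
        by (intro sum_mono osc_le) auto
      then show "(\<Sum>j<N ^ k. 1 + real N ^ (m + k) * osc (m + k) (p * N ^ k + j)) \<le> T"
        by (simp add: T_def)
    qed
    moreover have "(2 / len + 2) * ((4 * len + 2) * T) \<le> c * z powr (1 + e)"
    proof -
      have "T \<le> ((real N)\<^sup>2 * z) * ((B + C * L) * z powr e)"
        unfolding T_def using mk(3) Bz z \<open>1 \<le> B\<close> C(1) by (intro mult_mono) auto
      also have "\<dots> = (real N)\<^sup>2 * (B + C * L) * z powr (1 + e)"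
        using z by (simp add: powr_add)
      finally have "(2 / len + 2) * (4 * len + 2) * T
          \<le> (2 / len + 2) * (4 * len + 2) * ((real N)\<^sup>2 * (B + C * L) * z powr (1 + e))"
        using len_pos by (intro mult_left_mono) auto
      then show ?thesis by (simp add: c_def mult.assoc)
    qed
    ultimately have "coverable r (ball p R \<inter> \<Gamma>) (c * z powr (1 + e))"
      by (rule coverable_mono[OF _ order_refl])
    then show "coverable (R powr (1 / \<theta>)) (ball p R \<inter> \<Gamma>) (c * (R / R powr (1 / \<theta>)) powr (1 + e))"
      by (simp only: r_def z_def)
  qed
  then show "assouad_spectrum \<theta> \<Gamma> \<le> 1 + ereal e" by (simp add: one_ereal_def)
qed

lemma assouad_spectrum_ge_1:
  assumes "\<theta> \<in> {0<..<1}"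
  shows "1 \<le> assouad_spectrum \<theta> \<Gamma>"
proof (rule assouad_spectrum_connected_ge_1[OF assms connected_graph])
  show "(x 0, f (x 0)) \<in> \<Gamma>" "(x N, f (x N)) \<in> \<Gamma>" "(x 0, f (x 0)) \<noteq> (x N, f (x N))"
    using len_pos by (auto simp: graph_on_def len_def)
qed

text \<open>The cost of a ball splits into \<open>a ^ m\<close>, from iterating over the coarse
  levels, and \<open>weight k\<close>, from the fine ones; they contribute \<open>\<gamma>\<close>
  and \<open>s\<close> to the exponent of \<open>R / r\<close>.\<close>

lemma assouad_spectrum_le_aux:
  assumes \<theta>: "\<theta> \<in> {0<..<1}" and NA: "1 < real N * A"
    and s: "upper_box_dim \<Gamma> < ereal s"
  shows "assouad_spectrum \<theta> \<Gamma> \<le> ereal (s + \<theta> / (1 - \<theta>) * (1 + ln A / ln (real N)))"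
proof -
  define a where "a = real N * A"
  \<comment> \<open>The logarithm of \<open>a\<close> in base \<open>N\<close>, so that
    \<open>a ^ m\<close> is \<open>(real N ^ m) powr \<beta>\<close>.\<close>
  define \<beta> where "\<beta> = 1 + ln A / ln (real N)"
  define \<gamma> where "\<gamma> = \<theta> / (1 - \<theta>) * \<beta>"
  have a: "1 < a" using NA by (simp add: a_def)
  have lnN: "0 < ln (real N)" using N_gt_1 by simp
  have \<beta>: "\<beta> = ln a / ln (real N)"
    using A_pos N_pos lnN by (simp add: \<beta>_def a_def ln_mult add_divide_distrib)
  then have "0 < \<beta>" using a lnN by simp
  have "0 < s"
    using le_less_trans[OF upper_box_dim_nonneg s] by simp
  obtain C where C: "0 \<le> C" "\<And>m k q. q < N ^ (m + k) \<Longrightarrow> real N ^ (m + k) * osc (m + k) q \<le>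
    a ^ m * (real N ^ k * osc k (q mod N ^ k)) + C * (\<Sum>i<m. a ^ i)"
    using osc_iterate unfolding a_def by blast
  obtain W where W: "0 < W" "\<And>k. weight k \<le> W * (real N ^ k) powr s"
    using weight_le_powr[OF s] by blast
  \<comment> \<open>As \<open>a > 1\<close>, the geometric sum is at most
    \<open>a ^ m / (a - 1)\<close>, so the additive error of \<open>osc_iterate\<close> is at most
    \<open>a ^ m * (B - 1)\<close>.\<close>
  define B where "B = 1 + C / (a - 1)"
  have "1 \<le> B" using C(1) a by (simp add: B_def)
  have osc_le: "1 + real N ^ (m + k) * osc (m + k) q \<le> a ^ m * B * (1 + real N ^ k * osc k (q mod N ^ k))"
    if q: "q < N ^ (m + k)" for m k q
  proof -
    define w where "w = real N ^ k * osc k (q mod N ^ k)"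
    have "0 \<le> w" unfolding w_def using N_ge_2 by (simp add: osc_nonneg)
    have am: "1 \<le> a ^ m" using a by simp
    have "(\<Sum>i<m. a ^ i) = (a ^ m - 1) / (a - 1)" using a by (simp add: geometric_sum)
    also have "\<dots> \<le> a ^ m / (a - 1)" using a by (intro divide_right_mono) auto
    finally have "C * (\<Sum>i<m. a ^ i) \<le> C * (a ^ m / (a - 1))" using C(1) by (rule mult_left_mono)
    also have "\<dots> = a ^ m * (B - 1)" by (simp add: B_def)
    finally have "1 + real N ^ (m + k) * osc (m + k) q \<le> a ^ m + (a ^ m * w + a ^ m * (B - 1))"
      using C(2)[OF q] am by (simp add: w_def)
    also have "\<dots> = a ^ m * (B + w)" by (simp add: algebra_simps)
    also have "\<dots> \<le> a ^ m * (B * (1 + w))"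
      using am \<open>1 \<le> B\<close> \<open>0 \<le> w\<close> mult_right_mono[of 1 B w] by (intro mult_left_mono) (auto simp: distrib_left)
    finally show ?thesis by (simp add: w_def mult.assoc)
  qed
  define c where "c = (2 / len + 2) * (4 * len + 2) * (B * W * ((real N)\<^sup>2) powr s)"
  have "0 < c" unfolding c_def
    using len_pos N_pos \<open>1 \<le> B\<close> W(1) by (intro mult_pos_pos add_pos_nonneg) auto
  have "assouad_spectrum \<theta> \<Gamma> \<le> ereal (s + \<gamma>)"
  proof (rule assouad_spectrum_leI[OF \<open>0 < c\<close>])
    fix R :: real and p assume R: "0 < R" "R < 1"
    define r where "r = R powr (1 / \<theta>)"
    have r: "0 < r" "r < R" using powr_inverse_le[OF R \<theta>] by (auto simp: r_def)
    define z where "z = R / r"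
    have z: "0 < z" using r R by (simp add: z_def)
    obtain m k where mk: "real N ^ m * R \<le> 1" "1 \<le> real N ^ (m + k) * r"
      "real N ^ k \<le> (real N)\<^sup>2 * z"
      using scales[OF r R(2)] z_def by blast
    have "a ^ m \<le> z powr \<gamma>"
    proof -
      have "a = real N powr \<beta>" using N_pos a lnN by (simp add: \<beta> powr_def)
      then have "a ^ m = (real N ^ m) powr \<beta>"
        using N_pos by (simp add: powr_realpow[symmetric] powr_powr mult.commute)
      also have "\<dots> \<le> (1 / R) powr \<beta>"
        using mk(1) R \<open>0 < \<beta>\<close> by (intro powr_mono2) (auto simp: field_simps)
      also have "\<dots> = R powr - \<beta>" using R by (simp add: powr_divide powr_minus_divide)
      \<comment> \<open>\<open>z\<close> is \<open>R powr (1 - 1 / \<theta>)\<close>, and the factor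
        \<open>\<theta> / (1 - \<theta>)\<close> in \<open>\<gamma>\<close> is the negative
        reciprocal of \<open>1 - 1 / \<theta>\<close>.\<close>
      also have "- \<beta> = (1 - 1 / \<theta>) * \<gamma>"
        using \<theta> by (simp add: \<gamma>_def field_simps)
      also have "R powr ((1 - 1 / \<theta>) * \<gamma>) = z powr \<gamma>"
        using R by (simp add: z_def r_def powr_powr[symmetric] powr_diff)
      finally show ?thesis .
    qed
    moreover have "weight k \<le> W * (((real N)\<^sup>2) powr s * z powr s)"
    proof -
      have "(real N ^ k) powr s \<le> ((real N)\<^sup>2 * z) powr s"
        using mk(3) \<open>0 < s\<close> by (intro powr_mono2) auto
      also have "\<dots> = ((real N)\<^sup>2) powr s * z powr s" using z by (simp add: powr_mult)
      finally have "W * (real N ^ k) powr s \<le> W * (((real N)\<^sup>2) powr s * z powr s)"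
        using W(1) by (intro mult_left_mono) auto
      then show ?thesis using W(2)[of k] by linarith
    qed
    ultimately have "a ^ m * weight k \<le> z powr \<gamma> * (W * (((real N)\<^sup>2) powr s * z powr s))"
      using weight_nonneg by (intro mult_mono) auto
    then have "B * (a ^ m * weight k) \<le> B * (z powr \<gamma> * (W * (((real N)\<^sup>2) powr s * z powr s)))"
      using \<open>1 \<le> B\<close> by (intro mult_left_mono) auto
    also have "\<dots> = B * W * ((real N)\<^sup>2) powr s * z powr (s + \<gamma>)" by (simp add: powr_add)
    finally have T: "(2 / len + 2) * (4 * len + 2) * (B * (a ^ m * weight k))
        \<le> (2 / len + 2) * (4 * len + 2) * (B * W * ((real N)\<^sup>2) powr s * z powr (s + \<gamma>))"
      using len_pos by (intro mult_left_mono) auto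
    have "coverable r (ball p R \<inter> \<Gamma>) ((2 / len + 2) * ((4 * len + 2) * (B * (a ^ m * weight k))))"
    proof (rule coverable_ball_graph[OF less_imp_le[OF R(1)] mk(1,2)])
      fix p assume p: "p < N ^ m"
      \<comment> \<open>\<open>(p * N ^ k + j) mod N ^ k\<close> is \<open>j\<close>, so every
        coarse cell \<open>p\<close> leads to the same sum \<open>weight k\<close>.\<close>
      have "(\<Sum>j<N ^ k. 1 + real N ^ (m + k) * osc (m + k) (p * N ^ k + j))
          \<le> (\<Sum>j<N ^ k. a ^ m * B * (1 + real N ^ k * osc k j))"
      proof (rule sum_mono)
        fix j assume "j \<in> {..<N ^ k}"
        then show "1 + real N ^ (m + k) * osc (m + k) (p * N ^ k + j)
            \<le> a ^ m * B * (1 + real N ^ k * osc k j)"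
          using osc_le[OF index_less[OF p], of j k] by simp
      qed
      then show "(\<Sum>j<N ^ k. 1 + real N ^ (m + k) * osc (m + k) (p * N ^ k + j))
          \<le> B * (a ^ m * weight k)"
        by (simp add: weight_def sum_distrib_left[symmetric] mult_ac)
    qed
    then have "coverable r (ball p R \<inter> \<Gamma>) (c * z powr (s + \<gamma>))"
      by (rule coverable_mono[OF _ order_refl]) (use T in \<open>simp add: c_def mult.assoc\<close>)
    then show "coverable (R powr (1 / \<theta>)) (ball p R \<inter> \<Gamma>) (c * (R / R powr (1 / \<theta>)) powr (s + \<gamma>))"
      by (simp only: r_def z_def)
  qed
  then show ?thesis by (simp only: \<gamma>_def \<beta>_def)
qed

text \<open>Let \<open>s\<close> decrease to the upper box dimension. If that is infinite the bound
  is trivial, and minus infinity is impossible by \<open>upper_box_dim_nonneg\<close>.\<close>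

lemma assouad_spectrum_le_upper_box_dim:
  assumes "\<theta> \<in> {0<..<1}" "1 < real N * A"
  shows "assouad_spectrum \<theta> \<Gamma> \<le>
    upper_box_dim \<Gamma> + ereal (\<theta> / (1 - \<theta>) * (1 + ln A / ln (real N)))"
proof (cases "upper_box_dim \<Gamma>")
  case (real d)
  show ?thesis
  proof (rule ereal_le_epsilon2)
    fix e :: real assume "0 < e"
    then have "upper_box_dim \<Gamma> < ereal (d + e)" by (simp add: real)
    from assouad_spectrum_le_aux[OF assms this]
    show "assouad_spectrum \<theta> \<Gamma> \<le>
        upper_box_dim \<Gamma> + ereal (\<theta> / (1 - \<theta>) * (1 + ln A / ln (real N))) + ereal e"
      by (simp add: real add_ac)
  qed
next
  case MInf
  then show ?thesis using upper_box_dim_nonneg by simp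
qed simp

end

theorem theorem1p1:
  fixes N :: nat and x y :: "nat \<Rightarrow> real" and \<alpha> f :: "real \<Rightarrow> real"
  defines "\<Gamma> \<equiv> graph_on {x 0..x N} f"
    and "A \<equiv> sup_norm_on {x 0..x N} \<alpha>"
  assumes "N \<ge> 2"
    and "\<And>i. i < N \<Longrightarrow> x i < x (Suc i)"
    and "\<And>i. i \<in> {1..N} \<Longrightarrow> x i - x (i - 1) = (x N - x 0) / real N"
    and "\<And>t. t \<in> {x 0..x N} \<Longrightarrow> \<alpha> t \<in> {0<..<1}"
    and "\<exists>K. K-lipschitz_on {x 0..x N} \<alpha>"
    and "is_generalized_affine_fif N x y \<alpha> f"
  shows "(real N * A \<le> 1 \<longrightarrow>
            (\<forall>\<theta>\<in>{0<..<1}. assouad_spectrum \<theta> \<Gamma> = 1) \<and> quasi_assouad_dim \<Gamma> = 1) \<and>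
         (real N * A > 1 \<longrightarrow>
            (\<forall>\<theta>\<in>{0<..<1}. assouad_spectrum \<theta> \<Gamma> \<le>
               min 2 (upper_box_dim \<Gamma> +
                      ereal (\<theta> / (1 - \<theta>) * (1 + ln A / ln (real N))))))"
proof -
  interpret affine_fif N x y \<alpha> f
    using assms(3-8) by unfold_locales
  have one: "assouad_spectrum \<theta> \<Gamma> = 1" if "real N * A \<le> 1" "\<theta> \<in> {0<..<1}" for \<theta>
    using assouad_spectrum_le_1 assouad_spectrum_ge_1 that unfolding \<Gamma>_def A_def
    by (intro antisym)
  have "quasi_assouad_dim \<Gamma> = 1" if "real N * A \<le> 1"
  proof -
    \<comment> \<open>The spectrum is constant on \<open>{0<..<1}\<close>, a left neighbourhood of
      1, so it converges there and uniqueness of limits evaluates \<open>Lim\<close>.\<close>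
    have "eventually (\<lambda>\<theta>::real. \<theta> \<in> {0<..<1}) (at_left 1)"
      by (rule eventually_at_left_real) simp
    then have "eventually (\<lambda>\<theta>. assouad_spectrum \<theta> \<Gamma> = 1) (at_left 1)"
      by eventually_elim (rule one[OF that])
    then have "((\<lambda>\<theta>. assouad_spectrum \<theta> \<Gamma>) \<longlongrightarrow> 1) (at_left 1)"
      by (rule tendsto_eventually)
    then show ?thesis
      unfolding quasi_assouad_dim_def by (intro tendsto_Lim) auto
  qed
  moreover have "assouad_spectrum \<theta> \<Gamma> \<le> min 2 (upper_box_dim \<Gamma> +
      ereal (\<theta> / (1 - \<theta>) * (1 + ln A / ln (real N))))"
    if "real N * A > 1" "\<theta> \<in> {0<..<1}" for \<theta>
    using assouad_spectrum_le_upper_box_dim assouad_spectrum_le_2 that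
    unfolding \<Gamma>_def A_def by (intro min.boundedI)
  ultimately show ?thesis using one by blast
qed

end
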